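(* Let $(W,S)$ be a finite Coxeter system realized in $V$, let $T>0$, let $w\in W$ have length $p$, and let $\mathbf i=(s_1,\dots,s_p)$, $\mathbf j=(s_1',\dots,s_p')$ be two reduced decompositions $w=s_1\cdots s_p=s_1'\cdots s_p'$. For $\eta\in C_T^0(V)$ let $(x_1,\dots,x_p)$ and $(y_1,\dots,y_p)$ be the coordinates of $\eta$ with respect to $\mathbf i$ and $\mathbf j$ respectively. Then there exists a piecewise linear continuous map $\phi_{\mathbf i}^{\mathbf j}:\mathbb R^p\to\mathbb R^p$ such that for all paths $\eta\in C_T^0(V)$, $$(y_1,\dots,y_p)=\phi_{\mathbf i}^{\mathbf j}(x_1,\dots,x_p).$$
   Context: **Realization.** $V$ is a finite-dimensional real vector space with dual $V^\vee$, on which the finite Coxeter group $W$ (generated by the finite set of involutions $S$) acts so that $s(x)=x-\alpha_s^\vee(x)\alpha_s$ for $s\in S$, where $(\alpha_s,\alpha_s^\vee)\in V\times V^\vee$, $\alpha_s^\vee(\alpha_s)=2$. With $m(s,s')$ the order of $ss'$, as is standard, for $s\neq s'$: $\alpha_s^\vee(\alpha_{s'})=\alpha_{s'}^\vee(\alpha_s)=0$ if $m(s,s')=2$, otherwise both are negative with product $4\cos^2(\pi/m(s,s'))$. **Paths.** $C_T^0(V)$ is the set of continuous paths $\eta:[0,T]\to V$ with $\eta(0)=0$. For $s\in S$, $\mathcal P_s\eta(t)=\eta(t)-\inf_{0\le u\le t}\alpha_s^\vee(\eta(u))\,\alpha_s$. **Coordinates.** Given a reduced decomposition $w=s_1\cdots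 s_p$ and $\eta\in C_T^0(V)$, put $\eta_p=\eta$ and $\eta_{k-1}=\mathcal P_{s_k}\eta_k=\mathcal P_{s_k}\cdots\mathcal P_{s_p}\eta$ for $k=1,\dots,p$. The coordinates of $\eta$ with respect to $(s_1,\dots,s_p)$ are $x_k=-\inf_{0\le t\le T}\alpha_{s_k}^\vee(\eta_k(t))$, $k=1,\dots,p$. The coordinates $y_k$ are obtained in the same way from $(s_1',\dots,s_p')$. *)

theory Defs
  imports "HOL-Analysis.Analysis" "HOL-Algebra.Group_Action" "HOL-Algebra.Multiplicative_Group"
begin

section \<open>Coxeter systems\<close>

abbreviation word_prod :: "('w, 'm) monoid_scheme \<Rightarrow> 'w list \<Rightarrow> 'w"
  where "word_prod W ss \<equiv> foldr (\<otimes>\<^bsub>W\<^esub>) ss \<one>\<^bsub>W\<^esub>"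

definition cox_m :: "('w, 'm) monoid_scheme \<Rightarrow> 'w \<Rightarrow> 'w \<Rightarrow> nat"
  where "cox_m W s t = group.ord W (s \<otimes>\<^bsub>W\<^esub> t)"

text \<open>
  The congruence on the free monoid over \<open>S\<close> generated by the relations \<open>(s t)^m(s,t) = 1\<close>.
  For \<open>s = t\<close> the relation reads \<open>s s = 1\<close>, so every letter is its own inverse and this
  monoid presentation is the usual group presentation. If \<open>s t\<close> has infinite order then
  \<open>group.ord\<close> is \<open>0\<close> and the relation is void, as it should be.
\<close>
inductive cox_cong :: "('w, 'm) monoid_scheme \<Rightarrow> 'w set \<Rightarrow> 'w list \<Rightarrow> 'w list \<Rightarrow> bool"
  for W S where
  rel: "\<lbrakk>u \<in> lists S; v \<in> lists S; s \<in> S; t \<in> S\<rbrakk>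
    \<Longrightarrow> cox_cong W S (u @ concat (replicate (cox_m W s t) [s, t]) @ v) (u @ v)"
| refl: "u \<in> lists S \<Longrightarrow> cox_cong W S u u"
| sym: "cox_cong W S u v \<Longrightarrow> cox_cong W S v u"
| trans: "\<lbrakk>cox_cong W S u v; cox_cong W S v v'\<rbrakk> \<Longrightarrow> cox_cong W S u v'"

text \<open>
  The last assumption says that \<open>W\<close> is presented by the generators \<open>S\<close> and the relations
  above; the converse implication holds in every group.
\<close>
locale coxeter_system = group W for W :: "('w, 'm) monoid_scheme" (structure) +
  fixes S :: "'w set"
  assumes gens_closed: "S \<subseteq> carrier W"
    and finite_gens: "finite S"
    and generated: "generate W S = carrier W"
    and involution: "s \<in> S \<Longrightarrow> s \<noteq> \<one> \<and> s \<otimes> s = \<one>"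
    and presentation:
      "\<lbrakk>u \<in> lists S; v \<in> lists S; word_prod W u = word_prod W v\<rbrakk> \<Longrightarrow> cox_cong W S u v"

definition cox_length :: "('w, 'm) monoid_scheme \<Rightarrow> 'w set \<Rightarrow> 'w \<Rightarrow> nat"
  where "cox_length W S w = (LEAST n. \<exists>ss \<in> lists S. length ss = n \<and> word_prod W ss = w)"

definition reduced_decomposition ::
    "('w, 'm) monoid_scheme \<Rightarrow> 'w set \<Rightarrow> 'w list \<Rightarrow> 'w \<Rightarrow> bool"
  where "reduced_decomposition W S ss w \<longleftrightarrow>
    ss \<in> lists S \<and> word_prod W ss = w \<and> length ss = cox_length W S w"


section \<open>Realizations\<close>

text \<open>
  \<open>\<alpha> s\<close> is the root and \<open>\<alpha>v s\<close> the coroot of \<open>s\<close>; the inner product of the type \<open>'v\<close>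
  plays no role. Linearity of the action follows from that of the coroots.
\<close>
locale finite_coxeter_realization = coxeter_system W S
  for W :: "('w, 'm) monoid_scheme" (structure) and S :: "'w set" +
  fixes \<rho> :: "'w \<Rightarrow> 'v::euclidean_space \<Rightarrow> 'v"
    and \<alpha> :: "'w \<Rightarrow> 'v"
    and \<alpha>v :: "'w \<Rightarrow> 'v \<Rightarrow> real"
  assumes finite_W: "finite (carrier W)"
    and action: "group_action W UNIV \<rho>"
    and linear_coroot: "s \<in> S \<Longrightarrow> linear (\<alpha>v s)"
    and coroot_root: "s \<in> S \<Longrightarrow> \<alpha>v s (\<alpha> s) = 2"
    and reflection: "s \<in> S \<Longrightarrow> \<rho> s x = x - \<alpha>v s x *\<^sub>R \<alpha> s"
    and cartan_eq_2: "\<lbrakk>s \<in> S; t \<in> S; s \<noteq> t; cox_m W s t = 2\<rbrakk>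
      \<Longrightarrow> \<alpha>v s (\<alpha> t) = 0 \<and> \<alpha>v t (\<alpha> s) = 0"
    and cartan_neq_2: "\<lbrakk>s \<in> S; t \<in> S; s \<noteq> t; cox_m W s t \<noteq> 2\<rbrakk>
      \<Longrightarrow> \<alpha>v s (\<alpha> t) < 0 \<and> \<alpha>v t (\<alpha> s) < 0 \<and>
        \<alpha>v s (\<alpha> t) * \<alpha>v t (\<alpha> s) = 4 * (cos (pi / real (cox_m W s t)))\<^sup>2"


section \<open>Paths and their coordinates\<close>

text \<open>Only the values of a path on \<open>{0..T}\<close> are relevant.\<close>
definition paths0 :: "real \<Rightarrow> (real \<Rightarrow> 'v::euclidean_space) set"
  where "paths0 T = {\<eta>. continuous_on {0..T} \<eta> \<and> \<eta> 0 = 0}"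

definition path_transform ::
    "('w \<Rightarrow> 'v::euclidean_space) \<Rightarrow> ('w \<Rightarrow> 'v \<Rightarrow> real) \<Rightarrow> 'w \<Rightarrow> (real \<Rightarrow> 'v) \<Rightarrow> real \<Rightarrow> 'v"
  where "path_transform \<alpha> \<alpha>v s \<eta> = (\<lambda>t. \<eta> t - (INF u\<in>{0..t}. \<alpha>v s (\<eta> u)) *\<^sub>R \<alpha> s)"

text \<open>
  For \<open>ss = [s\<^sub>1, \<dots>, s\<^sub>p]\<close> the path \<open>\<eta>\<^sub>k\<close> is obtained from \<open>\<eta>\<close> by applying first the transform
  of \<open>s\<^sub>p\<close>, and last that of \<open>s\<^sub>k\<^sub>+\<^sub>1\<close>.
\<close>
definition partial_path ::
    "('w \<Rightarrow> 'v::euclidean_space) \<Rightarrow> ('w \<Rightarrow> 'v \<Rightarrow> real) \<Rightarrow> 'w list \<Rightarrow> (real \<Rightarrow> 'v) \<Rightarrow> nat \<Rightarrow> real \<Rightarrow> 'v"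
  where "partial_path \<alpha> \<alpha>v ss \<eta> k = foldr (path_transform \<alpha> \<alpha>v) (drop k ss) \<eta>"

text \<open>
  A point of \<open>\<real>\<^sup>p\<close> is a function on \<open>nat\<close> that vanishes from \<open>p\<close> on, as in
  \<^const>\<open>Euclidean_space\<close>. Indices start at \<open>0\<close>: the value at \<open>i\<close> is the coordinate \<open>x\<^sub>i\<^sub>+\<^sub>1\<close>.
\<close>
definition path_coords ::
    "('w \<Rightarrow> 'v::euclidean_space) \<Rightarrow> ('w \<Rightarrow> 'v \<Rightarrow> real) \<Rightarrow> real \<Rightarrow> 'w list \<Rightarrow> (real \<Rightarrow> 'v) \<Rightarrow> nat \<Rightarrow> real"
  where "path_coords \<alpha> \<alpha>v T ss \<eta> = (\<lambda>i. if i < length ss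
    then - (INF t\<in>{0..T}. \<alpha>v (ss ! i) (partial_path \<alpha> \<alpha>v ss \<eta> (Suc i) t)) else 0)"


section \<open>Piecewise linear maps\<close>

text \<open>Finite intersections of closed half-spaces \<open>a \<bullet> x \<le> b\<close> in \<open>\<real>\<^sup>n\<close>.\<close>
definition polyhedron_in :: "nat \<Rightarrow> (nat \<Rightarrow> real) set \<Rightarrow> bool"
  where "polyhedron_in n P \<longleftrightarrow> (\<exists>H. finite H \<and>
    P = {x \<in> topspace (Euclidean_space n). \<forall>(a, b)\<in>H. (\<Sum>j<n. a j * x j) \<le> b})"

text \<open>The matrix \<open>A\<close> describes the linear map that \<open>f\<close> agrees with on the piece \<open>P\<close>.\<close>
definition piecewise_linear :: "nat \<Rightarrow> nat \<Rightarrow> ((nat \<Rightarrow> real) \<Rightarrow> nat \<Rightarrow> real) \<Rightarrow> bool"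
  where "piecewise_linear n m f \<longleftrightarrow>
    f \<in> topspace (Euclidean_space n) \<rightarrow> topspace (Euclidean_space m) \<and>
    (\<exists>\<P>. finite \<P> \<and> \<Union>\<P> = topspace (Euclidean_space n) \<and>
      (\<forall>P\<in>\<P>. polyhedron_in n P \<and>
        (\<exists>A. \<forall>x\<in>P. \<forall>i<m. f x i = (\<Sum>j<n. A i j * x j))))"

end

theory Submission
  imports Defs
begin

text \<open>
  By Matsumoto's theorem two reduced words are connected by braid moves, so only two generators
  matter. There the coefficients of the roots in \<open>P\<^sub>\<alpha> P\<^sub>\<beta> P\<^sub>\<alpha> \<dots> \<eta>\<close> are infima of linear
  combinations of coroot values at decreasing times, with weights
  \<open>sin (k \<pi> / m) / sin (\<pi> / m)\<close>. As the weight for \<open>k = m\<close> vanishes, both words of length \<open>m\<close>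
  give the same transform.

  For the coordinates, continue a path with coordinates \<open>x\<close> after time \<open>T\<close>, first to a position
  depending linearly on \<open>x\<close> at which no coordinate has changed, then far in an antidominant
  direction. The transformed path after time \<open>T\<close> is a piecewise linear function of \<open>x\<close> and time
  by the forward recursion for the first word. Since it is also the transform for the second word,
  Pitman's inversion formula, which reads off the coordinates from the future of the transformed
  path, gives \<open>y\<close> as a piecewise linear function of \<open>x\<close>.
\<close>

section \<open>Lattice polynomials in linear forms\<close>

text \<open>Pitman's inversion at time \<open>T\<close> needs values of the transformed path after
  \<open>T\<close>, and one later value of the running maximum. The given path stops at
  \<open>T\<close>, and the coordinates do not even determine its end point. So the continuation may
  be chosen freely, but from some time on it has to be a function of the coordinates alone. The sum
  \<open>B\<close> of the coordinates is the same for both words, as it is the sum of the root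
  coefficients in the common transform; the point with both coroot values \<open>2 * B\<close>
  therefore favours neither word. In the antidominant direction the coordinates finally grow
  linearly with explicit slopes \<open>\<omega> j\<close>, and this supplies the missing later
  value.

  Both recursions take infima over time intervals whose ends vary. Piecewise linearity must survive
  such infima, which is why time is treated as one more variable and why the class is generated by
  \<open>max\<close> and \<open>min\<close>: on a segment the minimizers are then among finitely
  many piecewise linear candidates, and continuity comes for free.\<close>

definition lin_form :: "nat \<Rightarrow> (nat \<Rightarrow> real) \<Rightarrow> (nat \<Rightarrow> real) \<Rightarrow> real"
  where "lin_form n a x = (\<Sum>j<n. a j * x j)"

text \<open>The generators are linear rather than affine, since a piece of
  \<open>piecewise_linear\<close> is described by a matrix without constant term.\<close>

inductive pl :: "nat \<Rightarrow> ((nat \<Rightarrow> real) \<Rightarrow> real) \<Rightarrow> bool" for n where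
  lin: "pl n (lin_form n a)"
| max: "\<lbrakk>pl n f; pl n g\<rbrakk> \<Longrightarrow> pl n (\<lambda>x. max (f x) (g x))"
| min: "\<lbrakk>pl n f; pl n g\<rbrakk> \<Longrightarrow> pl n (\<lambda>x. min (f x) (g x))"

lemma pl_linI: "(\<And>x. f x = lin_form n a x) \<Longrightarrow> pl n f"
  using pl.lin[of n a] by (metis ext)

lemma pl_zero: "pl n (\<lambda>x. 0)"
  by (rule pl_linI[where a = "\<lambda>_. 0"]) (simp add: lin_form_def)

lemma pl_coord: "i < n \<Longrightarrow> pl n (\<lambda>x. x i)"
  by (rule pl_linI[where a = "\<lambda>j. if j = i then 1 else 0"])
     (simp add: lin_form_def if_distrib[of "\<lambda>c. c * _"] cong: if_cong)

text \<open>Addition distributes over \<open>max\<close> and \<open>min\<close>, so a nested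
  induction reduces to the sum of two linear forms.\<close>

lemma pl_add:
  assumes "pl n f" "pl n g"
  shows "pl n (\<lambda>x. f x + g x)"
  using assms(1)
proof induction
  case (lin a)
  from assms(2) show ?case
  proof induction
    case (lin b)
    show ?case
      by (rule pl_linI[where a = "\<lambda>j. a j + b j"])
         (simp add: lin_form_def sum.distrib algebra_simps)
  qed (auto simp: max_add_distrib_right min_add_distrib_right intro: pl.intros)
qed (auto simp: max_add_distrib_left min_add_distrib_left intro: pl.intros)

lemma pl_scale:
  assumes "pl n f"
  shows "pl n (\<lambda>x. c * f x)"
  using assms
proof induction
  case (lin a)
  show ?case
    by (rule pl_linI[where a = "\<lambda>j. c * a j"])
       (simp add: lin_form_def sum_distrib_left algebra_simps)
next
  case (max f g)
  show ?case
  proof (cases "c \<ge> 0")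
    case True
    then show ?thesis using pl.max[OF max.IH] by (simp add: max_mult_distrib_left)
  next
    case False
    then show ?thesis using pl.min[OF max.IH] by (simp add: max_mult_distrib_left)
  qed
next
  case (min f g)
  show ?case
  proof (cases "c \<ge> 0")
    case True
    then show ?thesis using pl.min[OF min.IH] by (simp add: min_mult_distrib_left)
  next
    case False
    then show ?thesis using pl.max[OF min.IH] by (simp add: min_mult_distrib_left)
  qed
qed

lemma pl_sum:
  assumes "\<And>i. i \<in> I \<Longrightarrow> pl n (f i)"
  shows "pl n (\<lambda>x. \<Sum>i\<in>I. f i x)"
proof (cases "finite I")
  case True
  from this assms show ?thesis
    by (induction I rule: finite_induct) (auto intro: pl_zero pl_add)
qed (simp add: pl_zero)

lemma pl_comp:
  assumes "pl n f" "\<And>i. i < n \<Longrightarrow> pl k (g i)"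
  shows "pl k (\<lambda>x. f (\<lambda>i. g i x))"
  using assms(1)
proof induction
  case (lin a)
  show ?case unfolding lin_form_def
    by (intro pl_sum pl_scale assms(2)) simp
qed (auto intro: pl.intros)

lemma pl_cong_arg:
  assumes "pl n f" "\<And>i. i < n \<Longrightarrow> x i = y i"
  shows "f x = f y"
  using assms(1) by induction (simp_all add: lin_form_def assms(2))

text \<open>The substituted index \<open>l\<close> may lie outside the \<open>k\<close> remaining
  variables, so fixing the last coordinate can lower the number of variables.\<close>

lemma pl_subst:
  assumes "pl n f" "pl k g" "\<And>i. \<lbrakk>i < n; i \<noteq> l\<rbrakk> \<Longrightarrow> i < k"
  shows "pl k (\<lambda>x. f (x(l := g x)))"
  unfolding fun_upd_def
proof (rule pl_comp[OF assms(1)])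
  fix i assume "i < n"
  then show "pl k (\<lambda>x. if i = l then g x else x i)"
    using assms(2,3) by (cases "i = l") (auto intro: pl_coord)
qed

lemma pl_Min:
  assumes "finite F" "F \<noteq> {}" "\<And>f. f \<in> F \<Longrightarrow> pl n (h f)"
  shows "pl n (\<lambda>x. Min ((\<lambda>f. h f x) ` F))"
  using assms
proof (induction F rule: finite_ne_induct)
  case (insert a F)
  have "Min ((\<lambda>f. h f x) ` insert a F) = min (h a x) (Min ((\<lambda>f. h f x) ` F))" for x
    using insert.hyps by simp
  with insert show ?case by (auto intro: pl.min)
qed auto

section \<open>Selection of linear forms, infima and polyhedral pieces\<close>

definition form_comparable :: "nat \<Rightarrow> (nat \<Rightarrow> real) set \<Rightarrow> (nat \<Rightarrow> real) set \<Rightarrow> bool"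
  where "form_comparable n L D \<longleftrightarrow> (\<forall>a\<in>L. \<forall>b\<in>L.
    (\<forall>x\<in>D. lin_form n a x \<le> lin_form n b x) \<or> (\<forall>x\<in>D. lin_form n b x \<le> lin_form n a x))"

lemma form_comparable_mono: "\<lbrakk>form_comparable n L D; L' \<subseteq> L\<rbrakk> \<Longrightarrow> form_comparable n L' D"
  unfolding form_comparable_def by blast

text \<open>Where the occurring forms keep a constant order, every \<open>max\<close> and
  \<open>min\<close> selects the same argument at all points, so a single form survives. As
  \<open>L\<close> is fixed before \<open>D\<close>, the domain can be refined until the order is
  constant.\<close>

lemma pl_selection:
  assumes "pl n f"
  shows "\<exists>L. finite L \<and>
    (\<forall>D. form_comparable n L D \<longrightarrow> (\<exists>a\<in>L. \<forall>x\<in>D. f x = lin_form n a x))"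
  using assms
proof induction
  case (lin a)
  show ?case by (rule exI[of _ "{a}"]) auto
next
  case (max f g)
  then obtain L1 L2 where L: "finite L1" "finite L2"
    "\<And>D. form_comparable n L1 D \<Longrightarrow> \<exists>a\<in>L1. \<forall>x\<in>D. f x = lin_form n a x"
    "\<And>D. form_comparable n L2 D \<Longrightarrow> \<exists>a\<in>L2. \<forall>x\<in>D. g x = lin_form n a x" by metis
  show ?case
  proof (intro exI[of _ "L1 \<union> L2"] conjI allI impI)
    fix D assume D: "form_comparable n (L1 \<union> L2) D"
    obtain a b where ab: "a \<in> L1" "b \<in> L2" "\<forall>x\<in>D. f x = lin_form n a x" "\<forall>x\<in>D. g x = lin_form n b x"
      using L(3,4) form_comparable_mono[OF D] by (meson Un_upper1 Un_upper2)
    from D ab(1,2) have "(\<forall>x\<in>D. lin_form n a x \<le> lin_form n b x) \<or> (\<forall>x\<in>D. lin_form n b x \<le> lin_form n a x)"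
      unfolding form_comparable_def by blast
    with ab show "\<exists>a\<in>L1 \<union> L2. \<forall>x\<in>D. max (f x) (g x) = lin_form n a x"
      by (metis UnI1 UnI2 max_absorb1 max_absorb2)
  qed (use L in auto)
next
  case (min f g)
  then obtain L1 L2 where L: "finite L1" "finite L2"
    "\<And>D. form_comparable n L1 D \<Longrightarrow> \<exists>a\<in>L1. \<forall>x\<in>D. f x = lin_form n a x"
    "\<And>D. form_comparable n L2 D \<Longrightarrow> \<exists>a\<in>L2. \<forall>x\<in>D. g x = lin_form n a x" by metis
  show ?case
  proof (intro exI[of _ "L1 \<union> L2"] conjI allI impI)
    fix D assume D: "form_comparable n (L1 \<union> L2) D"
    obtain a b where ab: "a \<in> L1" "b \<in> L2" "\<forall>x\<in>D. f x = lin_form n a x" "\<forall>x\<in>D. g x = lin_form n b x"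
      using L(3,4) form_comparable_mono[OF D] by (meson Un_upper1 Un_upper2)
    from D ab(1,2) have "(\<forall>x\<in>D. lin_form n a x \<le> lin_form n b x) \<or> (\<forall>x\<in>D. lin_form n b x \<le> lin_form n a x)"
      unfolding form_comparable_def by blast
    with ab show "\<exists>a\<in>L1 \<union> L2. \<forall>x\<in>D. min (f x) (g x) = lin_form n a x"
      by (metis UnI1 UnI2 min_absorb1 min_absorb2)
  qed (use L in auto)
qed

lemma lin_form_upd:
  assumes "k < n"
  shows "lin_form n a (x(k := u)) = lin_form n a (x(k := 0)) + a k * u"
proof -
  have "lin_form n a (x(k := u)) = (\<Sum>j\<in>{..<n}-{k}. a j * x j) + a k * u" for u
    using assms by (simp add: lin_form_def sum.remove[of "{..<n}" k])
  from this[of u] this[of 0] show ?thesis by simp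
qed

text \<open>
  On a segment in the direction of the \<open>k\<close>-th coordinate \<open>f\<close> is affine between consecutive
  crossings of the forms occurring in it, so the infimum is attained at an end point or at
  a crossing.
\<close>
lemma pl_INF:
  assumes f: "pl n f" and a: "pl n a" and b: "pl n b" and k: "k < n"
  shows "\<exists>g. pl n g \<and> (\<forall>x. a x \<le> b x \<longrightarrow> g x = (INF u\<in>{a x..b x}. f (x(k := u))))"
proof -
  obtain L where L: "finite L"
    "\<And>D. form_comparable n L D \<Longrightarrow> \<exists>e\<in>L. \<forall>x\<in>D. f x = lin_form n e x"
    using pl_selection[OF f] by metis
  \<comment> \<open>Solves \<open>p = q\<close> for the \<open>k\<close>-th coordinate in terms of
    the others. Parallel forms lead to a division by zero, hence to the value 0, which the clipping
    makes harmless.\<close>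
  define cross where "cross = (\<lambda>(p :: nat \<Rightarrow> real, q) x.
    (1 / (p k - q k)) * (lin_form n q (x(k := 0)) + (-1) * lin_form n p (x(k := 0))))"
  \<comment> \<open>Clipped candidates stay in the interval, so a minimum over them is a value of
    \<open>f\<close> on the segment.\<close>
  define clip where "clip = (\<lambda>pq x. max (a x) (min (b x) (cross pq x)))"
  define K where "K = {a, b} \<union> clip ` (L \<times> L)"
  define g where "g = (\<lambda>x. Min ((\<lambda>c. f (x(k := c x))) ` K))"
  have finK: "finite K" and neK: "K \<noteq> {}" using L(1) by (auto simp: K_def)
  have lin0: "pl n (\<lambda>x. lin_form n p (x(k := 0)))" for p
    by (rule pl_subst[OF pl.lin pl_zero])
  have "pl n (cross pq)" for pq
    unfolding cross_def case_prod_beta by (rule pl_scale[OF pl_add[OF lin0 pl_scale[OF lin0]]])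
  then have "pl n (clip pq)" for pq
    unfolding clip_def by (intro pl.max pl.min a b)
  then have plK: "pl n c" if "c \<in> K" for c using that a b by (auto simp: K_def)
  have "pl n g" unfolding g_def
    using finK neK by (rule pl_Min) (rule pl_subst[OF f plK])
  moreover have "g x = (INF u\<in>{a x..b x}. f (x(k := u)))" if ab: "a x \<le> b x" for x
  proof -
    let ?F = "\<lambda>u. f (x(k := u))"
    have in_ab: "a x \<le> c x \<and> c x \<le> b x" if "c \<in> K" for c
      using that ab by (auto simp: K_def clip_def)
    have low: "g x \<le> ?F v" if v: "v \<in> {a x..b x}" for v
    proof -
      \<comment> \<open>The candidates are split at \<open>v\<close>; \<open>p\<close> and
        \<open>q\<close> below are the nearest ones on either side.\<close>
      define P where "P = {y \<in> (\<lambda>c. c x) ` K. y \<le> v}"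
      define Q where "Q = {y \<in> (\<lambda>c. c x) ` K. v \<le> y}"
      have fin: "finite P" "finite Q" using finK by (auto simp: P_def Q_def)
      have "a x \<in> P" "b x \<in> Q" using v by (auto simp: P_def Q_def K_def)
      then have ne: "P \<noteq> {}" "Q \<noteq> {}" by auto
      define p q where "p = Max P" and "q = Min Q"
      have pP: "p \<in> P" and qQ: "q \<in> Q" using fin ne by (auto simp: p_def q_def)
      then have pv: "p \<le> v" "v \<le> q" by (auto simp: P_def Q_def)
      have gap: "\<not> (p < c x \<and> c x < q)" if "c \<in> K" for c
        using that Max_ge[OF fin(1)] Min_le[OF fin(2)]
        by (cases "c x \<le> v") (auto simp: P_def Q_def p_def q_def not_less)
      have pab: "a x \<le> p" "q \<le> b x" using pP qQ in_ab by (auto simp: P_def Q_def)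
      \<comment> \<open>A change of order would put a crossing strictly between \<open>p\<close> and
        \<open>q\<close>, but that crossing is itself a candidate.\<close>
      have "form_comparable n L ((\<lambda>u. x(k := u)) ` {p..q})"
        unfolding form_comparable_def
      proof (intro ballI, rule ccontr)
        fix d e assume de: "d \<in> L" "e \<in> L" and
          not_comp: "\<not> ((\<forall>y\<in>(\<lambda>u. x(k := u)) ` {p..q}. lin_form n d y \<le> lin_form n e y) \<or>
             (\<forall>y\<in>(\<lambda>u. x(k := u)) ` {p..q}. lin_form n e y \<le> lin_form n d y))"
        define A B where "A = lin_form n d (x(k := 0)) - lin_form n e (x(k := 0))" and "B = d k - e k"
        have diff: "lin_form n d (x(k := u)) - lin_form n e (x(k := u)) = A + B * u" for u
          unfolding A_def B_def lin_form_upd[OF k, of d x u] lin_form_upd[OF k, of e x u]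
          by (simp add: algebra_simps)
        from not_comp obtain u1 u2 where u: "u1 \<in> {p..q}" "u2 \<in> {p..q}"
          "lin_form n d (x(k := u1)) > lin_form n e (x(k := u1))"
          "lin_form n d (x(k := u2)) < lin_form n e (x(k := u2))"
          by (auto simp: not_le)
        have s: "A + B * u1 > 0" "A + B * u2 < 0"
          using u(3,4) diff[of u1] diff[of u2] by auto
        then have B: "B \<noteq> 0" by auto
        define u0 where "u0 = - A / B"
        have "A = - B * u0" using B by (simp add: u0_def)
        with s have "B * (u1 - u0) > 0" "B * (u2 - u0) < 0" by (simp_all add: algebra_simps)
        then have "u1 < u0 \<and> u0 < u2 \<or> u2 < u0 \<and> u0 < u1"
          by (auto simp: zero_less_mult_iff mult_less_0_iff)
        then have u0: "p < u0" "u0 < q" using u by auto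
        have "cross (d, e) x = u0"
          using B by (simp add: cross_def u0_def A_def B_def field_simps)
        then have "clip (d, e) x = u0" using u0 pab by (auto simp: clip_def)
        with gap[of "clip (d, e)"] u0 de show False by (auto simp: K_def)
      qed
      from L(2)[OF this] obtain e where e: "e \<in> L" "\<And>u. u \<in> {p..q} \<Longrightarrow> ?F u = lin_form n e (x(k := u))"
        by auto
      have e': "?F u = lin_form n e (x(k := 0)) + e k * u" if "u \<in> {p..q}" for u
        using e(2)[OF that] lin_form_upd[OF k, of e x u] by simp
      \<comment> \<open>On \<open>[p, q]\<close> the function is affine, so the end point in the
        descending direction bounds its value at \<open>v\<close> from below.\<close>
      have "?F p \<le> ?F v \<or> ?F q \<le> ?F v"
        using e'[of p] e'[of q] e'[of v] pv
        by (cases "e k \<ge> 0") (auto intro: mult_left_mono mult_left_mono_neg)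
      moreover have "g x \<le> ?F p" "g x \<le> ?F q"
        using pP qQ finK unfolding g_def P_def Q_def by (auto intro!: Min_le)
      ultimately show ?thesis by linarith
    qed
    have "g x \<in> ?F ` {a x..b x}"
    proof -
      have "g x \<in> (\<lambda>c. f (x(k := c x))) ` K"
        unfolding g_def using finK neK by (intro Min_in) auto
      then show ?thesis using in_ab by auto
    qed
    then show ?thesis
      using low by (intro cInf_eq_minimum[symmetric]) auto
  qed
  ultimately show ?thesis by blast
qed

lemma pl_continuous_map:
  assumes "pl n f"
  shows "continuous_map (Euclidean_space n) euclideanreal f"
  using assms
proof induction
  case (lin a)
  have "continuous_map (Euclidean_space n) euclideanreal (\<lambda>x. x i)" for i
    unfolding Euclidean_space_def
    by (intro continuous_map_from_subtopology continuous_map_product_projection) simp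
  then show ?case unfolding lin_form_def by (intro continuous_intros) auto
qed (auto intro: continuous_map_real_max continuous_map_real_min)

lemma topspace_Euclidean: "topspace (Euclidean_space n) = {x. \<forall>i\<ge>n. x i = 0}"
  by (simp add: topspace_Euclidean_space)

text \<open>One piece for every way to order the finitely many forms that occur.\<close>
lemma pl_family_pieces:
  fixes m :: nat
  assumes pl: "\<And>i. i < m \<Longrightarrow> pl n (f i)"
  shows "\<exists>\<P>. finite \<P> \<and> \<Union>\<P> = topspace (Euclidean_space n) \<and>
      (\<forall>P\<in>\<P>. polyhedron_in n P \<and>
        (\<exists>A. \<forall>x\<in>P. \<forall>i<m. f i x = (\<Sum>j<n. A i j * x j)))"
proof -
  have "\<exists>L. finite L \<and>
    (\<forall>D. form_comparable n L D \<longrightarrow> (\<exists>a\<in>L. \<forall>x\<in>D. f i x = lin_form n a x))" if "i < m" for i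
    using pl_selection[OF pl[OF that]] .
  then obtain L where L: "\<And>i. i < m \<Longrightarrow> finite (L i)"
    "\<And>i D. \<lbrakk>i < m; form_comparable n (L i) D\<rbrakk> \<Longrightarrow> \<exists>a\<in>L i. \<forall>x\<in>D. f i x = lin_form n a x"
    by metis
  define U where "U = (\<Union>i<m. L i)"
  have finU: "finite U" unfolding U_def using L(1) by (intro finite_UN_I) auto
  \<comment> \<open>Pairs outside \<open>R\<close> contribute the reverse inequality, also
    non-strict: pieces are closed and may overlap, yet every pair is comparable on each of
    them.\<close>
  define H where "H = (\<lambda>R. (\<lambda>(a, b). (\<lambda>j. a j - b j, 0 :: real)) ` R \<union>
      (\<lambda>(a, b). (\<lambda>j. b j - a j, 0)) ` (U \<times> U - R))"
  define piece where "piece = (\<lambda>R. {x \<in> topspace (Euclidean_space n).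
      \<forall>(a, b)\<in>H R. (\<Sum>j<n. a j * x j) \<le> b})"
  have piece: "x \<in> piece R \<longleftrightarrow> x \<in> topspace (Euclidean_space n) \<and>
      (\<forall>(a, b)\<in>R. lin_form n a x \<le> lin_form n b x) \<and>
      (\<forall>(a, b)\<in>U \<times> U - R. lin_form n b x \<le> lin_form n a x)" for x R
    unfolding piece_def H_def lin_form_def
    by (simp add: ball_Un case_prod_unfold left_diff_distrib sum_subtractf)
  show ?thesis
  proof (intro exI[of _ "piece ` Pow (U \<times> U)"] conjI ballI)
    show "\<Union> (piece ` Pow (U \<times> U)) = topspace (Euclidean_space n)"
    proof (intro equalityI subsetI)
      fix x assume x: "x \<in> topspace (Euclidean_space n)"
      define R where "R = {(a, b) \<in> U \<times> U. lin_form n a x \<le> lin_form n b x}"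
      have "x \<in> piece R" unfolding piece R_def using x by auto
      moreover have "R \<in> Pow (U \<times> U)" by (auto simp: R_def)
      ultimately show "x \<in> \<Union> (piece ` Pow (U \<times> U))" by (rule UN_I[rotated])
    qed (auto simp: piece)
  next
    fix P assume "P \<in> piece ` Pow (U \<times> U)"
    then obtain R where R: "R \<subseteq> U \<times> U" "P = piece R" by auto
    have "finite (H R)" using finite_subset[OF R(1)] finU by (auto simp: H_def)
    then show "polyhedron_in n P"
      unfolding polyhedron_in_def R(2) piece_def by (intro exI[of _ "H R"] conjI) simp_all
    have "form_comparable n U P"
      unfolding form_comparable_def R(2)
    proof (intro ballI)
      fix a b assume ab: "a \<in> U" "b \<in> U"
      show "(\<forall>x\<in>piece R. lin_form n a x \<le> lin_form n b x) \<or>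
          (\<forall>x\<in>piece R. lin_form n b x \<le> lin_form n a x)"
      proof (cases "(a, b) \<in> R")
        case False
        with ab show ?thesis by (intro disjI2) (auto simp: piece dest: bspec[of "U \<times> U - R" _ "(a, b)"])
      qed (intro disjI1, auto simp: piece)
    qed
    then have "form_comparable n (L i) P" if "i < m" for i
      by (rule form_comparable_mono) (use that in \<open>auto simp: U_def\<close>)
    with L(2) have "\<exists>a. \<forall>x\<in>P. f i x = lin_form n a x" if "i < m" for i
      using that by blast
    then obtain A where "\<And>i. i < m \<Longrightarrow> \<forall>x\<in>P. f i x = lin_form n (A i) x" by metis
    then show "\<exists>A. \<forall>x\<in>P. \<forall>i<m. f i x = (\<Sum>j<n. A i j * x j)"
      by (intro exI[of _ A]) (auto simp: lin_form_def)
  qed (use finU in auto)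
qed

lemma pl_family_map:
  fixes f :: "nat \<Rightarrow> (nat \<Rightarrow> real) \<Rightarrow> real" and m :: nat
  defines "\<phi> \<equiv> \<lambda>x i. if i < m then f i x else 0"
  assumes pl: "\<And>i. i < m \<Longrightarrow> pl n (f i)"
  shows "piecewise_linear n m \<phi>" "continuous_map (Euclidean_space n) (Euclidean_space m) \<phi>"
proof -
  show "piecewise_linear n m \<phi>"
    unfolding piecewise_linear_def
    using pl_family_pieces[of m n f, OF pl] by (auto simp: \<phi>_def topspace_Euclidean cong: conj_cong)
  have "continuous_map (Euclidean_space n) euclideanreal (\<lambda>x. \<phi> x i)" for i
    using pl_continuous_map[OF pl] by (cases "i < m") (auto simp: \<phi>_def)
  then show "continuous_map (Euclidean_space n) (Euclidean_space m) \<phi>"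
    unfolding Euclidean_space_def[of m]
    by (auto simp: continuous_map_in_subtopology continuous_map_componentwise_UNIV \<phi>_def)
qed

section \<open>Running maxima\<close>

text \<open>Clipping the time at \<open>0\<close> makes the identities below hold at all times.\<close>
definition rmax :: "(real \<Rightarrow> real) \<Rightarrow> real \<Rightarrow> real"
  where "rmax f t = (SUP u\<in>{0..max 0 t}. f u)"

lemma rmax_attained:
  assumes "continuous_on UNIV f"
  obtains u where "u \<in> {0..max 0 t}" "rmax f t = f u"
proof -
  have "\<exists>u\<in>{0..max 0 t}. \<forall>v\<in>{0..max 0 t}. f v \<le> f u"
    by (intro continuous_attains_sup continuous_on_subset[OF assms]) auto
  then obtain u where u: "u \<in> {0..max 0 t}" "\<And>v. v \<in> {0..max 0 t} \<Longrightarrow> f v \<le> f u" by blast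
  then have "rmax f t = f u"
    unfolding rmax_def by (intro cSup_eq_maximum) auto
  with u(1) show thesis by (rule that)
qed

lemma rmax_ge:
  assumes "continuous_on UNIV f" "0 \<le> u" "u \<le> max 0 t"
  shows "f u \<le> rmax f t"
proof -
  have "compact (f ` {0..max 0 t})"
    by (intro compact_continuous_image continuous_on_subset[OF assms(1)]) auto
  then have "bdd_above (f ` {0..max 0 t})"
    by (simp add: bounded_imp_bdd_above compact_imp_bounded)
  then show ?thesis unfolding rmax_def using assms by (intro cSUP_upper) auto
qed

lemma rmax_le: "(\<And>u. \<lbrakk>0 \<le> u; u \<le> max 0 t\<rbrakk> \<Longrightarrow> f u \<le> k) \<Longrightarrow> rmax f t \<le> k"
  unfolding rmax_def by (intro cSUP_least) auto

lemma rmax_cong: "(\<And>u. \<lbrakk>0 \<le> u; u \<le> max 0 t\<rbrakk> \<Longrightarrow> f u = g u) \<Longrightarrow> rmax f t = rmax g t"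
  unfolding rmax_def by (intro SUP_cong) auto

lemma rmax_mono:
  assumes "continuous_on UNIV f" "s \<le> t"
  shows "rmax f s \<le> rmax f t"
  using assms by (intro rmax_le rmax_ge) auto

lemma rmax_continuous:
  assumes f: "continuous_on UNIV f"
  shows "continuous_on UNIV (rmax f)"
proof -
  have "continuous_on {0..} (rmax f)"
  proof (unfold continuous_on_iff, intro ballI allI impI)
    fix t0 e :: real assume t0: "t0 \<in> {0..}" and e: "e > 0"
    from f e obtain d where d: "d > 0" "\<And>u. dist u t0 < d \<Longrightarrow> dist (f u) (f t0) < e / 2"
      unfolding continuous_on_iff by (metis UNIV_I half_gt_zero)
    \<comment> \<open>The running maximum can grow between \<open>s\<close> and \<open>t\<close>
      only through values of \<open>f\<close> after time \<open>s\<close>, and these stay below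
      \<open>f s + e\<close>.\<close>
    have close: "rmax f t < rmax f s + e"
      if st: "0 \<le> s" "s \<le> t" "dist s t0 < d" "dist t t0 < d" for s t
    proof -
      obtain u where u: "u \<in> {0..max 0 t}" "rmax f t = f u" using rmax_attained[OF f] .
      show ?thesis
      proof (cases "u \<le> s")
        case True
        then have "f u \<le> rmax f s" using u by (intro rmax_ge[OF f]) auto
        with u e show ?thesis by simp
      next
        case False
        then have "dist u t0 < d" using u st by (auto simp: dist_real_def)
        from d(2)[OF this] d(2)[OF st(3)] have "f u < f s + e" unfolding dist_real_def by linarith
        moreover have "f s \<le> rmax f s" using st by (intro rmax_ge[OF f]) auto
        ultimately show ?thesis using u by simp
      qed
    qed
    show "\<exists>d>0. \<forall>t\<in>{0..}. dist t t0 < d \<longrightarrow> dist (rmax f t) (rmax f t0) < e"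
    proof (intro exI[of _ d] conjI ballI impI d(1))
      fix t assume t: "t \<in> {0..}" "dist t t0 < d"
      show "dist (rmax f t) (rmax f t0) < e"
        using close[of t t0] close[of t0 t] rmax_mono[OF f, of t t0] rmax_mono[OF f, of t0 t] t t0 d(1) e
        by (cases "t \<le> t0") (auto simp: dist_real_def)
    qed
  qed
  then have "continuous_on UNIV (\<lambda>t. rmax f (max 0 t))"
    by (rule continuous_on_compose2) (auto intro!: continuous_intros)
  moreover have "rmax f (max 0 t) = rmax f t" for t by (simp add: rmax_def)
  ultimately show ?thesis by simp
qed

lemma rmax_scale:
  assumes "continuous_on UNIV f" "s \<ge> 0"
  shows "rmax (\<lambda>u. s * f u) t = s * rmax f t"
proof (rule antisym)
  show "rmax (\<lambda>u. s * f u) t \<le> s * rmax f t"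
    using assms by (intro rmax_le mult_left_mono rmax_ge) auto
  obtain u where "u \<in> {0..max 0 t}" "rmax f t = f u" using rmax_attained[OF assms(1)] .
  then show "s * rmax f t \<le> rmax (\<lambda>u. s * f u) t"
    using assms by (auto intro!: rmax_ge[of "\<lambda>u. s * f u"] continuous_intros)
qed

lemma rmax_restart:
  assumes "continuous_on UNIV f" "0 \<le> s" "s \<le> t"
  shows "rmax f t = max (rmax f s) (SUP u\<in>{s..t}. f u)"
proof -
  have c: "compact (f ` {a..b})" for a b
    by (intro compact_continuous_image continuous_on_subset[OF assms(1)]) auto
  have "max 0 t = t" "max 0 s = s" using assms by auto
  then have split: "{0..max 0 t} = {0..max 0 s} \<union> {s..t}"
    using ivl_disj_un_two_touch(4)[of 0 s t] assms by simp
  have "rmax f t = sup (rmax f s) (SUP u\<in>{s..t}. f u)"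
    unfolding rmax_def split using assms(2,3)
    by (intro cSUP_union bounded_imp_bdd_above compact_imp_bounded c) auto
  then show ?thesis by (simp add: sup_real_def)
qed

lemma attains_SUP:
  fixes f :: "real \<Rightarrow> real"
  assumes "continuous_on UNIV f" "v \<le> w"
  obtains u where "u \<in> {v..w}" "(SUP u\<in>{v..w}. f u) = f u" "\<And>s. s \<in> {v..w} \<Longrightarrow> f s \<le> f u"
proof -
  have "\<exists>u\<in>{v..w}. \<forall>s\<in>{v..w}. f s \<le> f u"
    using assms(2) by (intro continuous_attains_sup continuous_on_subset[OF assms(1)]) auto
  then obtain u where u: "u \<in> {v..w}" "\<And>s. s \<in> {v..w} \<Longrightarrow> f s \<le> f u" by blast
  moreover from u have "(SUP u\<in>{v..w}. f u) = f u" by (intro cSup_eq_maximum) auto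
  ultimately show thesis using that by blast
qed

lemma SUP_diff_const:
  fixes f :: "real \<Rightarrow> real"
  assumes "continuous_on UNIV f" "v \<le> w"
  shows "(SUP u\<in>{v..w}. f u + k) = (SUP u\<in>{v..w}. f u) + k"
proof -
  obtain u where u: "u \<in> {v..w}" "(SUP u\<in>{v..w}. f u) = f u" "\<And>s. s \<in> {v..w} \<Longrightarrow> f s \<le> f u"
    using attains_SUP[OF assms] by blast
  then have "(SUP u\<in>{v..w}. f u + k) = f u + k" by (intro cSup_eq_maximum) auto
  with u show ?thesis by simp
qed

text \<open>On an interval \<open>[v, w]\<close> where the running maximum \<open>x\<close> of \<open>- f\<close> increases, the left-hand side
  is attained at the time where it starts to increase, which satisfies \<open>- f = x = x v\<close>, and
  the maximum of \<open>- f\<close> is \<open>x w\<close>.\<close>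
lemma reflected_max:
  fixes f :: "real \<Rightarrow> real"
  defines "x \<equiv> rmax (\<lambda>u. - f u)"
  assumes f: "continuous_on UNIV f" and vw: "0 \<le> v" "v \<le> w"
  shows "(SUP u\<in>{v..w}. - f u - 2 * x u) = (SUP u\<in>{v..w}. - f u) - x v - x w"
proof -
  have mf: "continuous_on UNIV (\<lambda>u. - f u)" using f by (intro continuous_intros)
  have ge: "- f u \<le> x t" if "0 \<le> u" "u \<le> t" for u t
    unfolding x_def using that by (intro rmax_ge[OF mf]) auto
  have mono: "x s \<le> x t" if "s \<le> t" for s t unfolding x_def by (rule rmax_mono[OF mf that])
  show ?thesis
  proof (cases "x w = x v")
    case True
    then have const: "x u = x v" if "u \<in> {v..w}" for u
      using mono[of v u] mono[of u w] that by auto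
    have "(SUP u\<in>{v..w}. - f u - 2 * x u) = (SUP u\<in>{v..w}. - f u + (- 2 * x v))"
      by (rule SUP_cong[OF HOL.refl]) (frule const, simp)
    also have "\<dots> = (SUP u\<in>{v..w}. - f u) + (- 2 * x v)"
      by (rule SUP_diff_const[OF mf vw(2)])
    finally show ?thesis using True by simp
  next
    case False
    then have less: "x v < x w" using mono[OF vw(2)] by simp
    obtain a where a: "a \<in> {0..max 0 w}" "x w = - f a" unfolding x_def using rmax_attained[OF mf] .
    have av: "v < a" using ge[of a v] a less by (cases "v < a") auto
    have "- f v \<le> x v" "x v \<le> - f a" using ge vw a less by auto
    then obtain b0 where b0: "v \<le> b0" "b0 \<le> a" "- f b0 = x v"
      using IVT'[of "\<lambda>u. - f u" v "x v" a] av continuous_on_subset[OF mf] by auto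
    \<comment> \<open>The least element \<open>b\<close> of this set is the first time from
      \<open>v\<close> on at which \<open>- f\<close> hits the level \<open>x v\<close>. Until then
      \<open>- f\<close> cannot exceed that level, so \<open>x\<close> has not increased
      yet.\<close>
    define B where "B = {u \<in> {v..a}. - f u = x v}"
    have "closed B"
      unfolding B_def by (intro continuous_closed_preimage_constant continuous_on_subset[OF mf]) auto
    moreover have "bounded B" by (rule bounded_subset[of "{v..a}"]) (auto simp: B_def)
    ultimately have "compact B" by (simp add: compact_eq_bounded_closed)
    moreover have "B \<noteq> {}" using b0 by (auto simp: B_def)
    ultimately obtain b where b: "b \<in> B" "\<And>u. u \<in> B \<Longrightarrow> b \<le> u"
      using compact_attains_inf by metis
    have bv: "v \<le> b" "b \<le> a" "- f b = x v" using b(1) by (auto simp: B_def)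
    have "x b = x v"
    proof (rule antisym)
      show "x b \<le> x v"
        unfolding x_def
      proof (rule rmax_le, fold x_def)
        fix u assume u: "0 \<le> u" "u \<le> max 0 b"
        show "- f u \<le> x v"
        proof (rule ccontr)
          assume *: "\<not> - f u \<le> x v"
          then have uv: "v < u" using ge[of u v] u by force
          have ub: "u \<le> b" using u bv vw by auto
          obtain u' where "v \<le> u'" "u' \<le> u" "- f u' = x v"
            using IVT'[of "\<lambda>u. - f u" v "x v" u] uv * ge[of v v] vw continuous_on_subset[OF mf] by auto
          then have "u' \<in> B" "u' < b \<or> u' = u" using ub bv by (auto simp: B_def)
          with b(2)[of u'] * \<open>- f u' = x v\<close> show False by auto
        qed
      qed
    qed (use mono bv in auto)
    have "(SUP u\<in>{v..w}. - f u - 2 * x u) = - x v"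
    proof (rule cSup_eq_maximum)
      show "- x v \<in> (\<lambda>u. - f u - 2 * x u) ` {v..w}"
        using bv a \<open>x b = x v\<close> vw by (intro image_eqI[of _ _ b]) auto
    next
      fix y assume "y \<in> (\<lambda>u. - f u - 2 * x u) ` {v..w}"
      then obtain u where u: "u \<in> {v..w}" "y = - f u - 2 * x u" by auto
      then show "y \<le> - x v" using ge[of u u] mono[of v u] vw by auto
    qed
    moreover have "(SUP u\<in>{v..w}. - f u) = x w"
    proof (rule cSup_eq_maximum)
      show "x w \<in> (\<lambda>u. - f u) ` {v..w}" using a av vw by (auto simp: max_def)
    qed (use ge vw in auto)
    ultimately show ?thesis by simp
  qed
qed

text \<open>Inverse of the Pitman transform: the running maximum is read off from the future of
  the transformed path.\<close>
lemma rmax_from_future: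
  fixes f :: "real \<Rightarrow> real"
  defines "x \<equiv> rmax (\<lambda>u. - f u)"
  assumes f: "continuous_on UNIV f" and vw: "0 \<le> v" "v \<le> w"
  shows "x v = min (x w) (INF u\<in>{v..w}. f u + 2 * x u)"
proof -
  have mf: "continuous_on UNIV (\<lambda>u. - f u)" using f by (intro continuous_intros)
  have "(INF u\<in>{v..w}. f u + 2 * x u) = - (SUP u\<in>{v..w}. - f u - 2 * x u)"
    by (simp add: Inf_real_def image_image)
  also have "\<dots> = x v + x w - (SUP u\<in>{v..w}. - f u)"
    unfolding x_def reflected_max[OF f vw] by simp
  finally have inf: "(INF u\<in>{v..w}. f u + 2 * x u) = x v + x w - (SUP u\<in>{v..w}. - f u)" .
  \<comment> \<open>If the supremum over \<open>[v, w]\<close> exceeds \<open>x v\<close>, it equals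
    \<open>x w\<close> and cancels, and the infimum is \<open>x v\<close>; otherwise
    \<open>x w = x v\<close> and the infimum is not smaller.\<close>
  have "x w = max (x v) (SUP u\<in>{v..w}. - f u)" unfolding x_def by (rule rmax_restart[OF mf vw])
  then show ?thesis unfolding inf by (auto simp: max_def min_def)
qed

text \<open>Exchange the two suprema: for fixed \<open>u\<close> the outer one runs over
  \<open>v\<close> in \<open>[u, t]\<close>, and there \<open>reflected_max\<close> trades
  \<open>- f - 2 * x\<close> for \<open>- f\<close> at the price of \<open>x u + x t\<close>. The
  term with \<open>x u\<close> cancels against the inner \<open>s * x u\<close>, and
  \<open>x t\<close> is constant.\<close>

lemma rmax_two_step:
  fixes f A :: "real \<Rightarrow> real"
  defines "x \<equiv> rmax (\<lambda>u. - f u)"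
  assumes f: "continuous_on UNIV f" and A: "continuous_on UNIV A" and s: "s \<ge> 0"
  shows "rmax (\<lambda>v. - s * (f v + 2 * x v) + rmax (\<lambda>u. A u + s * x u) v) t =
    rmax (\<lambda>v. - s * f v + rmax A v) t - s * x t"
proof -
  have mf: "continuous_on UNIV (\<lambda>u. - f u)" using f by (intro continuous_intros)
  have x: "continuous_on UNIV x" unfolding x_def by (rule rmax_continuous[OF mf])
  have cL: "continuous_on UNIV (\<lambda>u. A u + s * x u)" by (intro continuous_intros A x)
  have cL2: "continuous_on UNIV (\<lambda>v. - s * (f v + 2 * x v) + rmax (\<lambda>u. A u + s * x u) v)"
    by (intro continuous_intros f x rmax_continuous cL)
  have cR2: "continuous_on UNIV (\<lambda>v. - s * f v + rmax A v)"
    by (intro continuous_intros f rmax_continuous A)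
  have cfx: "continuous_on UNIV (\<lambda>u. - f u - 2 * x u)" by (intro continuous_intros f x)
  let ?t = "max 0 t"
  have xt: "x ?t = x t" by (simp add: x_def rmax_def)
  show ?thesis
  proof (rule antisym)
    obtain v where v: "v \<in> {0..?t}"
      "rmax (\<lambda>v. - s * (f v + 2 * x v) + rmax (\<lambda>u. A u + s * x u) v) t =
        - s * (f v + 2 * x v) + rmax (\<lambda>u. A u + s * x u) v" using rmax_attained[OF cL2] .
    obtain u where u: "u \<in> {0..max 0 v}" "rmax (\<lambda>u. A u + s * x u) v = A u + s * x u"
      using rmax_attained[OF cL] .
    have ut: "0 \<le> u" "u \<le> ?t" "u \<le> v" using u v by auto
    obtain r where r: "r \<in> {u..?t}" "(SUP a\<in>{u..?t}. - f a) = - f r"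
      using attains_SUP[OF mf ut(2)] by blast
    obtain q where q: "(SUP a\<in>{u..?t}. - f a - 2 * x a) = - f q - 2 * x q"
      "\<And>a. a \<in> {u..?t} \<Longrightarrow> - f a - 2 * x a \<le> - f q - 2 * x q"
      using attains_SUP[OF cfx ut(2)] by blast
    have "- f v - 2 * x v \<le> - f r - x u - x t"
      using q(2)[of v] q(1) reflected_max[OF f ut(1,2)] r(2) v ut xt unfolding x_def by auto
    then have "s * (- f v - 2 * x v) \<le> s * (- f r - x u - x t)" using s by (rule mult_left_mono)
    moreover have "- s * f r + rmax A r \<le> rmax (\<lambda>v. - s * f v + rmax A v) t"
      using r ut by (intro rmax_ge[OF cR2, of r]) auto
    moreover have "A u \<le> rmax A r" using r ut by (intro rmax_ge[OF A]) auto
    ultimately show "rmax (\<lambda>v. - s * (f v + 2 * x v) + rmax (\<lambda>u. A u + s * x u) v) t \<le>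
        rmax (\<lambda>v. - s * f v + rmax A v) t - s * x t"
      unfolding v(2) u(2) by (simp add: algebra_simps)
  next
    obtain v where v: "v \<in> {0..?t}"
      "rmax (\<lambda>v. - s * f v + rmax A v) t = - s * f v + rmax A v" using rmax_attained[OF cR2] .
    obtain u where u: "u \<in> {0..max 0 v}" "rmax A v = A u" using rmax_attained[OF A] .
    have ut: "0 \<le> u" "u \<le> ?t" "u \<le> v" using u v by auto
    obtain q where q: "q \<in> {u..?t}" "(SUP a\<in>{u..?t}. - f a - 2 * x a) = - f q - 2 * x q"
      using attains_SUP[OF cfx ut(2)] by blast
    obtain r where r: "(SUP a\<in>{u..?t}. - f a) = - f r"
      "\<And>a. a \<in> {u..?t} \<Longrightarrow> - f a \<le> - f r"
      using attains_SUP[OF mf ut(2)] by blast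
    have "- f v - x u - x t \<le> - f q - 2 * x q"
      using r(2)[of v] r(1) reflected_max[OF f ut(1,2)] q(2) v ut xt unfolding x_def by auto
    then have "s * (- f v - x u - x t) \<le> s * (- f q - 2 * x q)" using s by (rule mult_left_mono)
    moreover have "- s * (f q + 2 * x q) + rmax (\<lambda>u. A u + s * x u) q \<le>
        rmax (\<lambda>v. - s * (f v + 2 * x v) + rmax (\<lambda>u. A u + s * x u) v) t"
      using q ut by (intro rmax_ge[OF cL2, of q]) auto
    moreover have "A u + s * x u \<le> rmax (\<lambda>u. A u + s * x u) q"
      using q ut by (intro rmax_ge[OF cL]) auto
    ultimately show "rmax (\<lambda>v. - s * f v + rmax A v) t - s * x t \<le>
        rmax (\<lambda>v. - s * (f v + 2 * x v) + rmax (\<lambda>u. A u + s * x u) v) t"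
      unfolding v(2) u(2) by (simp add: algebra_simps)
  qed
qed

section \<open>Alternating transforms in rank two\<close>

text \<open>A path \<open>\<eta>\<close> is represented by its two coroot values \<open>z True = \<alpha>\<^sup>\<or>(\<eta>)\<close> and
  \<open>z False = \<beta>\<^sup>\<or>(\<eta>)\<close>, with the roots scaled such that \<open>\<alpha>\<^sup>\<or>(\<beta>) = \<beta>\<^sup>\<or>(\<alpha>) = - c\<close>.\<close>

definition car :: "real \<Rightarrow> bool \<Rightarrow> bool \<Rightarrow> real"
  where "car c a b = (if a = b then 2 else - c)"

definition push :: "real \<Rightarrow> bool \<Rightarrow> (bool \<Rightarrow> real \<Rightarrow> real) \<Rightarrow> bool \<Rightarrow> real \<Rightarrow> real"
  where "push c b z = (\<lambda>a t. z a t + car c a b * rmax (\<lambda>u. - z b u) t)"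

definition letter :: "bool \<Rightarrow> nat \<Rightarrow> bool"
  where "letter b i = (if even i then b else \<not> b)"

text \<open>The transforms are applied in the order \<open>letter b 0, letter b 1, \<dots>\<close>.\<close>
primrec stage :: "real \<Rightarrow> bool \<Rightarrow> (bool \<Rightarrow> real \<Rightarrow> real) \<Rightarrow> nat \<Rightarrow> bool \<Rightarrow> real \<Rightarrow> real" where
  "stage c b z 0 = z"
| "stage c b z (Suc i) = push c (letter b i) (stage c b z i)"

definition coord :: "real \<Rightarrow> bool \<Rightarrow> (bool \<Rightarrow> real \<Rightarrow> real) \<Rightarrow> nat \<Rightarrow> real \<Rightarrow> real"
  where "coord c b z i = rmax (\<lambda>u. - stage c b z i (letter b i) u)"

text \<open>The coefficient of the root \<open>a\<close> in the difference between the transformed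
  path and the original one; two words give the same transform once these coefficients
  agree.\<close>

definition letter_total :: "real \<Rightarrow> bool \<Rightarrow> (bool \<Rightarrow> real \<Rightarrow> real) \<Rightarrow> nat \<Rightarrow> bool \<Rightarrow> real \<Rightarrow> real"
  where "letter_total c b z n a t = (\<Sum>i<n. if letter b i = a then coord c b z i t else 0)"

abbreviation cont2 :: "(bool \<Rightarrow> real \<Rightarrow> real) \<Rightarrow> bool"
  where "cont2 z \<equiv> \<forall>b. continuous_on UNIV (z b)"

lemma letter_0 [simp]: "letter b 0 = b"
  and letter_Suc: "letter b (Suc i) = letter (\<not> b) i"
  and letter_Suc': "letter b (Suc i) = (\<not> letter b i)"
  and letter_Not: "letter (\<not> b) i = (\<not> letter b i)"
  by (auto simp: letter_def)

lemma cont2_push: "cont2 z \<Longrightarrow> cont2 (push c b z)"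
  unfolding push_def by (auto intro!: continuous_intros rmax_continuous)

lemma cont2_stage: "cont2 z \<Longrightarrow> cont2 (stage c b z i)"
proof (induction i)
  case (Suc i)
  then show ?case using cont2_push[of "stage c b z i"] by simp
qed simp

lemma cont2_neg_stage: "cont2 z \<Longrightarrow> continuous_on UNIV (\<lambda>u. - stage c b z i a u)"
  using cont2_stage[of z c b i] by (auto intro!: continuous_intros)

lemma stage_push: "stage c b z (Suc i) = stage c (\<not> b) (push c b z) i"
  by (induction i) (simp_all add: letter_Suc)

lemma coord_push: "coord c b z (Suc i) = coord c (\<not> b) (push c b z) i"
  unfolding coord_def stage_push letter_Suc ..

lemma coord_0: "coord c b z 0 = rmax (\<lambda>u. - z b u)"
  by (simp add: coord_def)

lemma stage_eq: "stage c b z n a t = z a t + (\<Sum>i<n. car c a (letter b i) * coord c b z i t)"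
  by (induction n) (simp_all add: push_def coord_def)

lemma stage_eq_letter_total:
  "stage c b z n a t = z a t + (\<Sum>e\<in>UNIV. car c a e * letter_total c b z n e t)"
proof -
  have "(\<Sum>e\<in>UNIV. car c a e * letter_total c b z n e t) =
      (\<Sum>i<n. \<Sum>e\<in>UNIV. car c a e * (if letter b i = e then coord c b z i t else 0))"
    unfolding letter_total_def sum_distrib_left by (rule sum.swap)
  also have "\<dots> = (\<Sum>i<n. car c a (letter b i) * coord c b z i t)"
    by (intro sum.cong) (auto simp: UNIV_bool)
  finally show ?thesis by (simp add: stage_eq)
qed

lemma letter_total_Suc:
  "letter_total c b z (Suc n) a t = (if b = a then coord c b z 0 t else 0) + letter_total c (\<not> b) (push c b z) n a t"
  unfolding letter_total_def sum.lessThan_Suc_shift letter_Suc coord_push by simp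

lemma sum_letter_total: "(\<Sum>e\<in>UNIV. letter_total c b z n e t) = (\<Sum>i<n. coord c b z i t)"
  unfolding letter_total_def by (subst sum.swap) (simp add: UNIV_bool)

text \<open>\<open>\<theta> = \<pi> / m\<close>, \<open>c = 2 cos \<theta>\<close>, \<open>\<sigma> k = sin (k \<theta>) / sin \<theta>\<close>.\<close>
locale rank_two =
  fixes c :: real and \<sigma> :: "nat \<Rightarrow> real" and m :: nat
  assumes m2: "m \<ge> 2" and c_nonneg: "0 \<le> c" and c_le: "c \<le> 2"
    and \<sigma>_0: "\<sigma> 0 = 0" and \<sigma>_1: "\<sigma> (Suc 0) = 1"
    and \<sigma>_rec: "\<sigma> (Suc (Suc k)) = c * \<sigma> (Suc k) - \<sigma> k"
    and \<sigma>_pos: "\<lbrakk>0 < k; k < m\<rbrakk> \<Longrightarrow> \<sigma> k > 0"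
    and \<sigma>_m: "\<sigma> m = 0"
begin

lemma \<sigma>_nonneg: "k \<le> m \<Longrightarrow> \<sigma> k \<ge> 0"
  using \<sigma>_pos[of k] \<sigma>_0 \<sigma>_m by (cases "k = 0"; cases "k = m") (auto intro: less_imp_le)

text \<open>\<open>chain z a k n t\<close> is the supremum of
  \<open>- \<sigma> k * z a u\<^sub>0 - \<sigma> (k + 1) * z (\<not> a) u\<^sub>1 - \<sigma> (k + 2) * z a u\<^sub>2 - \<dots>\<close> (\<open>n\<close> terms) over
  \<open>t \<ge> u\<^sub>0 \<ge> u\<^sub>1 \<ge> \<dots> \<ge> 0\<close>.\<close>
primrec chain :: "(bool \<Rightarrow> real \<Rightarrow> real) \<Rightarrow> nat \<Rightarrow> bool \<Rightarrow> nat \<Rightarrow> real \<Rightarrow> real" where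
  "chain z 0 a k t = 0"
| "chain z (Suc n) a k t = rmax (\<lambda>u. - \<sigma> k * z a u + chain z n (\<not> a) (Suc k) u) t"

lemma chain_continuous: "cont2 z \<Longrightarrow> continuous_on UNIV (chain z n a k)"
proof (induction n arbitrary: a k)
  case 0
  have "chain z 0 a k = (\<lambda>t. 0)" by auto
  then show ?case by simp
next
  case (Suc n)
  have "chain z (Suc n) a k = rmax (\<lambda>u. - \<sigma> k * z a u + chain z n (\<not> a) (Suc k) u)" by auto
  with Suc show ?case by (auto intro!: rmax_continuous continuous_intros)
qed

text \<open>Two terms are absorbed at a time by \<open>rmax_two_step\<close>. The recursion in the
  form \<open>c * \<sigma> (k + 1) - \<sigma> (k + 2) = \<sigma> k\<close> produces exactly the
  multiple of the running maximum required there, and \<open>k + 2 * r \<le> m\<close> keeps the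
  weights in question nonnegative.\<close>

lemma chain_push_same:
  assumes z: "cont2 z" and k: "k + 2 * r \<le> m"
  shows "chain (push c b z) (2 * r) b k t =
    chain z (Suc (2 * r)) b k t - \<sigma> k * rmax (\<lambda>u. - z b u) t"
  using k
proof (induction r arbitrary: k t)
  case 0
  have "rmax (\<lambda>u. \<sigma> k * (- z b u)) t = \<sigma> k * rmax (\<lambda>u. - z b u) t"
    using 0 z by (intro rmax_scale \<sigma>_nonneg) (auto intro!: continuous_intros)
  then show ?case by simp
next
  case (Suc r)
  define x where "x = rmax (\<lambda>u. - z b u)"
  define A where "A = (\<lambda>u. - \<sigma> (Suc k) * z (\<not> b) u + chain z (Suc (2 * r)) b (Suc (Suc k)) u)"
  have A: "continuous_on UNIV A"
    unfolding A_def using z chain_continuous[OF z] by (auto intro!: continuous_intros simp del: chain.simps)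
  have IH: "chain (push c b z) (2 * r) b (Suc (Suc k)) u =
      chain z (Suc (2 * r)) b (Suc (Suc k)) u - \<sigma> (Suc (Suc k)) * x u" for u
    using Suc.IH[of "Suc (Suc k)"] Suc.prems by (simp add: x_def del: chain.simps)
  have push: "push c b z (\<not> b) u = z (\<not> b) u - c * x u" for u
    by (simp add: push_def car_def x_def)
  have "- \<sigma> (Suc k) * push c b z (\<not> b) u + chain (push c b z) (2 * r) b (Suc (Suc k)) u = A u + \<sigma> k * x u" for u
    unfolding IH A_def push \<sigma>_rec by (simp add: algebra_simps del: chain.simps)
  then have "chain (push c b z) (Suc (2 * r)) (\<not> b) (Suc k) v = rmax (\<lambda>u. A u + \<sigma> k * x u) v" for v
    by (simp only: chain.simps not_not)
  then have "chain (push c b z) (2 * Suc r) b k t =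
      rmax (\<lambda>v. - \<sigma> k * (z b v + 2 * x v) + rmax (\<lambda>u. A u + \<sigma> k * x u) v) t"
    by (simp add: push_def car_def x_def[symmetric] algebra_simps)
  also have "\<dots> = rmax (\<lambda>v. - \<sigma> k * z b v + rmax A v) t - \<sigma> k * x t"
    unfolding x_def using z A Suc.prems by (intro rmax_two_step \<sigma>_nonneg) auto
  also have "rmax (\<lambda>v. - \<sigma> k * z b v + rmax A v) t = chain z (Suc (2 * Suc r)) b k t"
    unfolding A_def by simp
  finally show ?case unfolding x_def .
qed

text \<open>The remainder \<open>- \<sigma> 2 * x\<close> from the shorter chain cancels the
  contribution \<open>c * x\<close> of the off-diagonal Cartan entry, because
  \<open>\<sigma> 2 = c\<close>.\<close>

lemma chain_push_other:
  assumes z: "cont2 z" and r: "2 + 2 * r \<le> m"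
  shows "chain (push c b z) (Suc (2 * r)) (\<not> b) 1 t = chain z (Suc (Suc (2 * r))) (\<not> b) 1 t"
proof -
  have "- \<sigma> 1 * push c b z (\<not> b) u + chain (push c b z) (2 * r) b (Suc 1) u =
     - \<sigma> 1 * z (\<not> b) u + chain z (Suc (2 * r)) b (Suc 1) u" for u
    using chain_push_same[OF z, of "Suc 1" r b u] r \<sigma>_rec[of 0] \<sigma>_0 \<sigma>_1
    by (simp add: push_def car_def algebra_simps del: chain.simps)
  then show ?thesis by (subst (1 2) chain.simps(2)) (simp only: not_not)
qed

lemma chain_push:
  assumes z: "cont2 z" and n: "n < m" and last: "letter a n = b"
  shows "(if a = b then coord c b z 0 t else 0) + chain (push c b z) n a 1 t = chain z (Suc n) a 1 t"
proof (cases "even n")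
  case True
  then obtain r where r: "n = 2 * r" by blast
  from last True have "a = b" by (simp add: letter_def)
  then show ?thesis
    unfolding r using chain_push_same[OF z, of 1 r b t] n r \<sigma>_1
    by (simp add: coord_0 del: chain.simps)
next
  case False
  then obtain r where r: "n = Suc (2 * r)" using oddE by (metis Suc_eq_plus1)
  from last False have "a = (\<not> b)" by (auto simp: letter_def)
  then show ?thesis
    unfolding r using chain_push_other[OF z, of r b t] n r by (simp del: chain.simps)
qed

text \<open>The chain has the right number of terms for it to end in the letter \<open>b\<close>, which is the
  one applied first.\<close>
lemma letter_total_eq_chain:
  assumes "cont2 z" "n \<le> m"
  shows "letter_total c b z n a t = chain z (if letter b n = a then n - 1 else n) a 1 t"
  using assms
proof (induction n arbitrary: b z)
  case 0
  then show ?case by (simp add: letter_total_def)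
next
  case (Suc n)
  have IH: "letter_total c (\<not> b) (push c b z) n a t =
      chain (push c b z) (if letter b (Suc n) = a then n - 1 else n) a 1 t"
    using Suc.IH[of "push c b z" "\<not> b"] cont2_push[OF Suc.prems(1)] Suc.prems(2)
    by (simp add: letter_Suc)
  show ?case
  proof (cases "letter b (Suc n) = a")
    case False
    then have "letter a n = b" by (auto simp: letter_def split: if_splits)
    then show ?thesis
      using False chain_push[OF Suc.prems(1), of n a b t] Suc.prems(2)
      unfolding letter_total_Suc IH by (auto simp del: chain.simps)
  next
    case True
    show ?thesis
    proof (cases n)
      case 0
      with True show ?thesis unfolding letter_total_Suc IH by (auto simp: letter_def)
    next
      case (Suc n')
      then have "letter a n' = b" using True by (auto simp: letter_def split: if_splits)
      then show ?thesis
        using True Suc chain_push[OF Suc.prems(1), of n' a b t] \<open>Suc n \<le> m\<close>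
        unfolding letter_total_Suc IH by (auto simp del: chain.simps)
    qed
  qed
qed

text \<open>The innermost running maximum is that of the constant 0, its weight being zero.\<close>

lemma chain_drop_last: "\<sigma> (k + n) = 0 \<Longrightarrow> chain z (Suc n) a k t = chain z n a k t"
proof (induction n arbitrary: a k t)
  case 0
  then show ?case by (simp add: rmax_def)
next
  case (Suc n)
  then have "chain z (Suc n) (\<not> a) (Suc k) u = chain z n (\<not> a) (Suc k) u" for u
    by (intro Suc.IH) simp
  then show ?case by (subst (1 2) chain.simps(2)) simp
qed

theorem letter_total_braid:
  assumes "cont2 z"
  shows "letter_total c b z m a t = letter_total c b' z m a t"
proof -
  have "letter_total c e z m a t = chain z (m - 1) a 1 t" for e
    using letter_total_eq_chain[OF assms, of m e a t] chain_drop_last[of 1 "m - 1" z a t] \<sigma>_m m2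
    by (auto simp del: chain.simps)
  then show ?thesis by simp
qed

end

text \<open>\<open>h \<tau> v\<close> depends on \<open>\<tau> \<in> A\<close> only through the vector \<open>xs \<tau>\<close>, and piecewise linearly on
  this vector and the time \<open>v \<in> [0, H \<tau>]\<close>, which is stored in the coordinate \<open>n\<close>.\<close>
definition rep :: "nat \<Rightarrow> 'a set \<Rightarrow> ('a \<Rightarrow> nat \<Rightarrow> real) \<Rightarrow> ('a \<Rightarrow> real) \<Rightarrow> ('a \<Rightarrow> real \<Rightarrow> real) \<Rightarrow> bool"
  where "rep n A xs H h \<longleftrightarrow>
    (\<exists>g. pl (Suc n) g \<and> (\<forall>\<tau>\<in>A. \<forall>v\<in>{0..H \<tau>}. h \<tau> v = g ((xs \<tau>)(n := v))))"

lemma repI: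
  "\<lbrakk>pl (Suc n) g; \<And>\<tau> v. \<lbrakk>\<tau> \<in> A; 0 \<le> v; v \<le> H \<tau>\<rbrakk> \<Longrightarrow> h \<tau> v = g ((xs \<tau>)(n := v))\<rbrakk> \<Longrightarrow> rep n A xs H h"
  unfolding rep_def by auto

lemma repE:
  assumes "rep n A xs H h"
  obtains g where "pl (Suc n) g" "\<And>\<tau> v. \<lbrakk>\<tau> \<in> A; 0 \<le> v; v \<le> H \<tau>\<rbrakk> \<Longrightarrow> h \<tau> v = g ((xs \<tau>)(n := v))"
  using assms unfolding rep_def by auto

lemma rep_cong:
  assumes "rep n A xs H h" "\<And>\<tau> v. \<lbrakk>\<tau> \<in> A; 0 \<le> v; v \<le> H \<tau>\<rbrakk> \<Longrightarrow> h' \<tau> v = h \<tau> v"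
  shows "rep n A xs H h'"
  using assms unfolding rep_def by auto

lemma rep_time: "rep n A xs H (\<lambda>\<tau> v. v)"
  by (rule repI[OF pl_coord[of n]]) auto

lemma rep_vector:
  assumes "pl n f"
  shows "rep n A xs H (\<lambda>\<tau> v. f (xs \<tau>))"
proof (rule repI)
  show "pl (Suc n) f" using pl_comp[OF assms, of "Suc n" "\<lambda>i x. x i"] by (simp add: pl_coord)
  show "f (xs \<tau>) = f ((xs \<tau>)(n := v))" for \<tau> v by (rule pl_cong_arg[OF assms]) simp
qed

lemma rep_add:
  assumes "rep n A xs H h" "rep n A xs H h'"
  shows "rep n A xs H (\<lambda>\<tau> v. h \<tau> v + h' \<tau> v)"
  using assms by (elim repE) (rule repI[OF pl_add], auto)

lemma rep_scale:
  assumes "rep n A xs H h"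
  shows "rep n A xs H (\<lambda>\<tau> v. k * h \<tau> v)"
  using assms by (elim repE) (rule repI[OF pl_scale], auto)

lemma rep_sum:
  assumes "\<And>i. i \<in> I \<Longrightarrow> rep n A xs H (h i)"
  shows "rep n A xs H (\<lambda>\<tau> v. \<Sum>i\<in>I. h i \<tau> v)"
proof (cases "finite I")
  case True
  from this assms show ?thesis
    by (induction I rule: finite_induct) (auto intro: rep_add rep_vector[OF pl_zero])
qed (simp add: rep_vector[OF pl_zero])

lemma rep_max:
  assumes "rep n A xs H h" "rep n A xs H h'"
  shows "rep n A xs H (\<lambda>\<tau> v. max (h \<tau> v) (h' \<tau> v))"
  using assms by (elim repE) (rule repI[OF pl.max], auto)

lemma rep_min:
  assumes "rep n A xs H h" "rep n A xs H h'"
  shows "rep n A xs H (\<lambda>\<tau> v. min (h \<tau> v) (h' \<tau> v))"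
  using assms by (elim repE) (rule repI[OF pl.min], auto)

text \<open>The bounds may depend on the outer time, because \<open>pl_INF\<close> is applied in the
  time coordinate itself. The premise \<open>ab\<close> keeps the inner time within the range where
  \<open>h\<close> is represented.\<close>

lemma rep_INF:
  assumes h: "rep n A xs H h" and a: "rep n A xs H a" and b: "rep n A xs H b"
    and ab: "\<And>\<tau> v. \<lbrakk>\<tau> \<in> A; 0 \<le> v; v \<le> H \<tau>\<rbrakk> \<Longrightarrow> 0 \<le> a \<tau> v \<and> a \<tau> v \<le> b \<tau> v \<and> b \<tau> v \<le> H \<tau>"
  shows "rep n A xs H (\<lambda>\<tau> v. INF u\<in>{a \<tau> v..b \<tau> v}. h \<tau> u)"
proof -
  obtain g where g: "pl (Suc n) g" "\<And>\<tau> v. \<lbrakk>\<tau> \<in> A; 0 \<le> v; v \<le> H \<tau>\<rbrakk> \<Longrightarrow> h \<tau> v = g ((xs \<tau>)(n := v))"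
    using h by (rule repE) blast
  obtain a' where a': "pl (Suc n) a'" "\<And>\<tau> v. \<lbrakk>\<tau> \<in> A; 0 \<le> v; v \<le> H \<tau>\<rbrakk> \<Longrightarrow> a \<tau> v = a' ((xs \<tau>)(n := v))"
    using a by (rule repE) blast
  obtain b' where b': "pl (Suc n) b'" "\<And>\<tau> v. \<lbrakk>\<tau> \<in> A; 0 \<le> v; v \<le> H \<tau>\<rbrakk> \<Longrightarrow> b \<tau> v = b' ((xs \<tau>)(n := v))"
    using b by (rule repE) blast
  obtain k where k: "pl (Suc n) k"
    "\<And>x. a' x \<le> b' x \<Longrightarrow> k x = (INF u\<in>{a' x..b' x}. g (x(n := u)))"
    using pl_INF[OF g(1) a'(1) b'(1), of n] by auto
  show ?thesis
  proof (rule repI[OF k(1)])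
    fix \<tau> v assume \<tau>: "\<tau> \<in> A" "0 \<le> v" "v \<le> H \<tau>"
    let ?x = "(xs \<tau>)(n := v)"
    have "k ?x = (INF u\<in>{a' ?x..b' ?x}. g (?x(n := u)))"
      using k(2)[of ?x] ab[OF \<tau>] a'(2)[OF \<tau>] b'(2)[OF \<tau>] by simp
    also have "\<dots> = (INF u\<in>{a \<tau> v..b \<tau> v}. g (?x(n := u)))"
      using a'(2)[OF \<tau>] b'(2)[OF \<tau>] by simp
    also have "\<dots> = (INF u\<in>{a \<tau> v..b \<tau> v}. h \<tau> u)"
      using ab[OF \<tau>] \<tau>(1) by (intro INF_cong) (auto simp: g(2))
    finally show "(INF u\<in>{a \<tau> v..b \<tau> v}. h \<tau> u) = k ?x" ..
  qed
qed

lemma rep_SUP_past: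
  assumes "rep n A xs H h"
  shows "rep n A xs H (\<lambda>\<tau> v. SUP u\<in>{0..v}. h \<tau> u)"
proof -
  have "rep n A xs H (\<lambda>\<tau> v. INF u\<in>{0..v}. (-1) * h \<tau> u)"
    using rep_vector[OF pl_zero] by (rule rep_INF[OF rep_scale[OF assms] _ rep_time]) auto
  then have "rep n A xs H (\<lambda>\<tau> v. (-1) * (INF u\<in>{0..v}. (-1) * h \<tau> u))" by (rule rep_scale)
  then show ?thesis by (rule rep_cong) (simp add: Inf_real_def image_image)
qed

section \<open>Continuation of a path beyond time \<open>T\<close>\<close>

lemma coord_nonneg:
  assumes "cont2 z" "\<And>e. z e 0 = 0"
  shows "coord c b z i t \<ge> 0"
proof -
  have "stage c b z i a 0 = 0" for a
    by (induction i arbitrary: a) (simp_all add: push_def rmax_def assms(2))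
  then show ?thesis
    using rmax_ge[OF cont2_neg_stage[OF assms(1)], of 0 t c b i "letter b i"] by (simp add: coord_def)
qed

lemma coord_mono: "\<lbrakk>cont2 z; s \<le> t\<rbrakk> \<Longrightarrow> coord c b z i s \<le> coord c b z i t"
  unfolding coord_def by (intro rmax_mono cont2_neg_stage)

lemma coord_ge_stage:
  "\<lbrakk>cont2 z; 0 \<le> u; u \<le> t\<rbrakk> \<Longrightarrow> - stage c b z i (letter b i) u \<le> coord c b z i t"
  unfolding coord_def by (intro rmax_ge[OF cont2_neg_stage]) auto

lemma stage_local:
  assumes "\<And>e u. u \<le> T \<Longrightarrow> z e u = z' e u" "0 \<le> T" "t \<le> T"
  shows "stage c b z i a t = stage c b z' i a t"
  using assms(3)
proof (induction i arbitrary: a t)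
  case (Suc i)
  have "rmax (\<lambda>u. - stage c b z i (letter b i) u) t = rmax (\<lambda>u. - stage c b z' i (letter b i) u) t"
    using Suc assms(2) by (intro rmax_cong) auto
  with Suc show ?case by (simp add: push_def)
qed (simp add: assms(1))

lemma coord_local:
  assumes "\<And>e u. u \<le> T \<Longrightarrow> z e u = z' e u" "0 \<le> T" "t \<le> T"
  shows "coord c b z i t = coord c b z' i t"
  unfolding coord_def using assms by (intro rmax_cong arg_cong[where f = uminus] stage_local[of T]) auto

text \<open>After time \<open>T\<close> the path first goes straight to the point where both coroots have the value
  \<open>2 * B\<close>, and from there in an antidominant direction.\<close>
definition extend :: "real \<Rightarrow> real \<Rightarrow> (bool \<Rightarrow> real \<Rightarrow> real) \<Rightarrow> bool \<Rightarrow> real \<Rightarrow> real"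
  where "extend B T z = (\<lambda>e t. z e (min t T) + min 1 (max 0 (t - T)) * (2 * B - z e T) - max 0 (t - T - 1))"

lemma extend_cont2: "cont2 z \<Longrightarrow> cont2 (extend B T z)"
  unfolding extend_def
  by (intro allI continuous_intros continuous_on_compose2[of UNIV "z _" UNIV "\<lambda>t. min t T"]) auto

lemma extend_before: "t \<le> T \<Longrightarrow> extend B T z e t = z e t"
  and extend_between: "\<lbrakk>T \<le> t; t \<le> T + 1\<rbrakk> \<Longrightarrow> extend B T z e t = (1 - (t - T)) * z e T + (t - T) * (2 * B)"
  and extend_after: "0 \<le> v \<Longrightarrow> extend B T z e (T + 1 + v) = 2 * B - v"
  by (auto simp: extend_def algebra_simps)

context rank_two
begin

text \<open>The slope of the \<open>j\<close>-th coordinate when both coroot values fall at unit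
  speed and all transforms are active.\<close>

definition \<omega> :: "nat \<Rightarrow> real"
  where "\<omega> j = \<sigma> (Suc j) + \<sigma> j"

lemma \<omega>_pos: "j < m \<Longrightarrow> \<omega> j > 0"
proof -
  assume j: "j < m"
  show ?thesis
  proof (cases "j = 0")
    case False
    then show ?thesis using j \<sigma>_pos[of j] \<sigma>_nonneg[of "Suc j"] by (simp add: \<omega>_def)
  qed (simp add: \<omega>_def \<sigma>_0 \<sigma>_1)
qed

text \<open>Letters two apart agree, so from \<open>j\<close> to \<open>j + 2\<close> the right-hand
  side changes by \<open>c * \<omega> (j + 1) - 2 * \<omega> j\<close>, in accordance with the
  recursion inherited from \<open>\<sigma>\<close>.\<close>

lemma \<omega>_sum: "\<omega> j = 1 - (\<Sum>i<j. car c (letter b j) (letter b i) * \<omega> i)"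
proof (induction j rule: induct_nat_012)
  case (ge2 j)
  have [simp]: "letter b (Suc (Suc j)) = letter b j" by (simp add: letter_def)
  have "\<omega> (Suc (Suc j)) = c * \<omega> (Suc j) - \<omega> j"
    by (simp add: \<omega>_def \<sigma>_rec algebra_simps)
  with ge2(1) show ?case by (simp add: car_def letter_Suc')
qed (simp_all add: \<omega>_def \<sigma>_0 \<sigma>_1 \<sigma>_rec car_def letter_def)

lemma car_bounds: "car c a e \<ge> - 2" "car c a e \<le> 2"
  using c_nonneg c_le by (auto simp: car_def)

definition csum :: "bool \<Rightarrow> (bool \<Rightarrow> real \<Rightarrow> real) \<Rightarrow> real \<Rightarrow> real"
  where "csum b z T = (\<Sum>i<m. coord c b z i T)"

context
  fixes z :: "bool \<Rightarrow> real \<Rightarrow> real" and T :: real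
  assumes z: "cont2 z" and z0: "\<And>e. z e 0 = 0" and T: "T \<ge> 0"
begin

lemma csum_indep: "csum b z T = csum b' z T"
  unfolding csum_def sum_letter_total[symmetric] by (intro sum.cong letter_total_braid[OF z] HOL.refl)

lemma coord_le_csum: "i < m \<Longrightarrow> coord c b z i T \<le> csum b' z T"
  unfolding csum_indep[of b' b] unfolding csum_def
  by (rule member_le_sum) (auto intro: coord_nonneg[OF z z0])

lemma csum_nonneg: "csum b z T \<ge> 0"
  unfolding csum_def by (intro sum_nonneg coord_nonneg[OF z z0])

abbreviation "B \<equiv> csum True z T"
abbreviation "Z \<equiv> extend B T z"

lemmas Z = extend_cont2[OF z, of B T]

lemma Z_0: "Z e 0 = 0"
  using T by (simp add: extend_before z0)

lemma coord_extend_T: "coord c b Z i T = coord c b z i T"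
  using T by (intro coord_local[of T]) (auto simp: extend_before)

text \<open>With the earlier coordinates frozen, the stage is affine along the straight piece, so
  its two ends decide. At \<open>T\<close> the bound is the definition of the coordinate. At
  \<open>T + 1\<close> the value \<open>2 * B\<close> outweighs the earlier coordinates, which enter
  with coefficients at least \<open>- 2\<close> and have sum at most \<open>B\<close>; this is the
  origin of the factor 2.\<close>

lemma stage_lower_bound:
  assumes "T \<le> u" "u \<le> T + 1" "i < m"
    and same: "\<And>j. j < i \<Longrightarrow> coord c b Z j u = coord c b z j T"
  shows "- stage c b Z i (letter b i) u \<le> coord c b z i T"
proof -
  let ?l = "letter b i" and ?x = "\<lambda>j. coord c b z j T"
  define s where "s = u - T"
  have s: "0 \<le> s" "s \<le> 1" using assms by (auto simp: s_def)
  define q where "q = (\<Sum>j<i. car c ?l (letter b j) * ?x j)"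
  have x: "?x j \<ge> 0" for j by (rule coord_nonneg[OF z z0])
  have 1: "- (z ?l T + q) \<le> ?x i"
    using coord_ge_stage[OF z T order_refl, of c b i] by (simp add: stage_eq q_def)
  have "- q \<le> (\<Sum>j<i. 2 * ?x j)"
    unfolding q_def sum_negf[symmetric]
  proof (intro sum_mono)
    fix j
    have "(- car c ?l (letter b j)) * ?x j \<le> 2 * ?x j"
      using car_bounds(1)[of ?l "letter b j"] by (intro mult_right_mono x) auto
    then show "- (car c ?l (letter b j) * ?x j) \<le> 2 * ?x j" by simp
  qed
  also have "\<dots> = 2 * (\<Sum>j<i. ?x j)" by (simp add: sum_distrib_left)
  also have "(\<Sum>j<i. ?x j) \<le> csum b z T"
    unfolding csum_def using assms x by (intro sum_mono2) auto
  finally have 2: "- (2 * B + q) \<le> ?x i" using x[of i] csum_indep[of b True] by simp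
  have "- stage c b Z i ?l u = (1 - s) * - (z ?l T + q) + s * - (2 * B + q)"
    using assms same by (simp add: stage_eq extend_between q_def s_def algebra_simps)
  also have "\<dots> \<le> (1 - s) * ?x i + s * ?x i"
    using s 1 2 by (intro add_mono mult_left_mono) auto
  finally show ?thesis by (simp add: algebra_simps)
qed

lemma coord_extend_between_True:
  assumes "T \<le> t" "t \<le> T + 1" "i < m"
  shows "coord c True Z i t = coord c True z i T"
  using assms
proof (induction i arbitrary: t rule: less_induct)
  case (less i)
  have "(SUP u\<in>{T..t}. - stage c True Z i (letter True i) u) \<le> coord c True z i T"
    using less by (intro cSUP_least stage_lower_bound) auto
  then show ?case
    using rmax_restart[OF cont2_neg_stage[OF Z] T less.prems(1), of c True i "letter True i"]
      coord_extend_T[of True i]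
    by (simp add: coord_def)
qed

text \<open>The coordinates for the two words have the same sum, so the straight piece changes neither.\<close>
lemma coord_extend_T1:
  assumes "i < m"
  shows "coord c b Z i (T + 1) = coord c b z i T"
proof -
  have "(\<Sum>i<m. coord c b Z i (T + 1)) = (\<Sum>i<m. coord c True Z i (T + 1))"
    unfolding sum_letter_total[symmetric] by (intro sum.cong letter_total_braid[OF Z] HOL.refl)
  also have "\<dots> = (\<Sum>i<m. coord c True z i T)"
    by (intro sum.cong HOL.refl coord_extend_between_True) auto
  also have "\<dots> = csum True z T" by (simp add: csum_def)
  also have "\<dots> = (\<Sum>i<m. coord c b z i T)" using csum_indep unfolding csum_def .
  finally have "(\<Sum>i<m. coord c b z i T) = (\<Sum>i<m. coord c b Z i (T + 1))" ..
  \<comment> \<open>Coordinates never decrease in time, so equal sums force equality term by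
    term.\<close>
  from sum_mono_inv[OF this] assms show ?thesis
    using coord_mono[OF Z, of T "T + 1" c b] coord_extend_T by auto
qed

lemma coord_extend_after:
  assumes "0 \<le> v" "i < m"
  shows "coord c b Z i (T + 1 + v) =
    max (coord c b z i T) (SUP u\<in>{0..v}. - stage c b Z i (letter b i) (T + 1 + u))"
proof -
  have "{T + 1..T + 1 + v} = (+) (T + 1) ` {0..v}" by simp
  then have "(SUP u\<in>{T + 1..T + 1 + v}. g u) = (SUP u\<in>{0..v}. g (T + 1 + u))" for g :: "real \<Rightarrow> real"
    by (simp only: image_image)
  then show ?thesis
    using rmax_restart[OF cont2_neg_stage[OF Z], of "T + 1" "T + 1 + v" c b i "letter b i"]
      coord_extend_T1[OF assms(2)] T assms(1)
    by (simp add: coord_def)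
qed

end

text \<open>In the antidominant direction eventually every transform is active.\<close>
lemma coord_extend_eventually:
  assumes "k \<le> m"
  shows "\<exists>M\<ge>0. \<forall>z T b. cont2 z \<and> (\<forall>e. z e 0 = 0) \<and> T \<ge> 0 \<longrightarrow>
    (\<forall>j<k. \<forall>v\<ge>M * csum True z T.
      coord c b (extend (csum True z T) T z) j (T + 1 + (2 * csum True z T + v)) = \<omega> j * v)"
  using assms
proof (induction k)
  case 0
  then show ?case by (intro exI[of _ 0]) auto
next
  case (Suc k)
  then obtain M where M: "M \<ge> 0"
    "\<And>z T b j v. \<lbrakk>cont2 z; \<And>e. z e 0 = 0; T \<ge> 0; j < k; v \<ge> M * csum True z T\<rbrakk> \<Longrightarrow>
      coord c b (extend (csum True z T) T z) j (T + 1 + (2 * csum True z T + v)) = \<omega> j * v"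
    by (auto simp: Suc_le_eq)
  \<comment> \<open>\<open>N * csum\<close> bounds the negated stage until the earlier coordinates
    are linear, and \<open>M'\<close> makes \<open>\<omega> k * v\<close> reach both this bound and
    \<open>csum\<close>. The constants do not depend on the path, so that the waiting time is linear
    in the coordinates.\<close>
  define N where "N = M + (\<Sum>j<k. 2 * (\<omega> j * M))"
  define M' where "M' = M + (N + 1) / \<omega> k"
  have \<omega>k: "\<omega> k > 0" using Suc.prems by (intro \<omega>_pos) simp
  have N: "N \<ge> 0"
    unfolding N_def using M(1) Suc.prems \<omega>_pos by (intro add_nonneg_nonneg sum_nonneg mult_nonneg_nonneg) (auto intro: less_imp_le)
  have M': "M' \<ge> M" "\<omega> k * M' \<ge> N" "\<omega> k * M' \<ge> 1"
    using N M(1) \<omega>k by (auto simp: M'_def field_simps intro!: add_nonneg_nonneg)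
  have new: "coord c b (extend (csum True z T) T z) k (T + 1 + (2 * csum True z T + v)) = \<omega> k * v"
    if z: "cont2 z" "\<And>e. z e 0 = 0" "T \<ge> 0" and v: "v \<ge> M' * csum True z T" for z T b v
  proof -
    let ?B = "csum True z T"
    let ?Z = "extend ?B T z" and ?l = "letter b k"
    have B: "?B \<ge> 0" by (rule csum_nonneg[OF z])
    have Z: "cont2 ?Z" by (rule extend_cont2[OF z(1)])
    have k: "k < m" using Suc.prems by simp
    \<comment> \<open>After the extra time \<open>2 * ?B\<close> both coroot values are back at 0,
      so here they equal \<open>- w\<close>, and \<open>\<omega>_sum\<close> evaluates the
      stage.\<close>
    have late: "- stage c b ?Z k ?l (T + 1 + (2 * ?B + w)) = \<omega> k * w" if w: "w \<ge> M * ?B" for w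
    proof -
      have w0: "w \<ge> 0" using w M(1) B by (meson mult_nonneg_nonneg order_trans)
      have "stage c b ?Z k ?l (T + 1 + (2 * ?B + w)) = - w + (\<Sum>i<k. car c ?l (letter b i) * (\<omega> i * w))"
        unfolding stage_eq using M(2)[OF z _ w] w0 B by (simp add: extend_after)
      also have "(\<Sum>i<k. car c ?l (letter b i) * (\<omega> i * w)) = (1 - \<omega> k) * w"
        unfolding \<omega>_sum[of k b] by (simp add: sum_distrib_right mult.assoc)
      finally show ?thesis by (simp add: algebra_simps)
    qed
    have vM: "v \<ge> M * ?B" using v mult_right_mono[OF M'(1) B] by linarith
    have Bv: "?B \<le> \<omega> k * v" "N * ?B \<le> \<omega> k * v"
    proof -
      note mult_right_mono[OF M'(2) B] mult_right_mono[OF M'(3) B]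
      moreover have "\<omega> k * (M' * ?B) \<le> \<omega> k * v" using v \<omega>k by simp
      ultimately show "?B \<le> \<omega> k * v" "N * ?B \<le> \<omega> k * v" by (simp_all add: mult.assoc)
    qed
    have v0: "v \<ge> 0" using vM M(1) B by (meson mult_nonneg_nonneg order_trans)
    show ?thesis
    proof (rule antisym)
      show "coord c b ?Z k (T + 1 + (2 * ?B + v)) \<le> \<omega> k * v"
        unfolding coord_def
      proof (rule rmax_le)
        fix u assume u: "0 \<le> u" "u \<le> max 0 (T + 1 + (2 * ?B + v))"
        \<comment> \<open>Up to \<open>T + 1\<close> the old coordinate is a bound, in the middle
          range \<open>N * ?B\<close> is one, and later the stage is linear.\<close>
        consider "u \<le> T + 1" | "T + 1 \<le> u" "u \<le> T + 1 + (2 * ?B + M * ?B)" |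
          "T + 1 + (2 * ?B + M * ?B) \<le> u" by linarith
        then show "- stage c b ?Z k ?l u \<le> \<omega> k * v"
        proof cases
          case 1
          then have "- stage c b ?Z k ?l u \<le> coord c b z k T"
            using coord_ge_stage[OF Z u(1) 1, of c b k] coord_extend_T1[OF z k] by simp
          also have "\<dots> \<le> ?B" by (rule coord_le_csum[OF z k])
          finally show ?thesis using Bv by simp
        next
          case 2
          define w where "w = u - (T + 1)"
          have w: "0 \<le> w" "u = T + 1 + w" using 2 by (auto simp: w_def)
          have "- (car c ?l (letter b i) * coord c b ?Z i u) \<le> 2 * (\<omega> i * M) * ?B" if "i < k" for i
          proof -
            have nn: "coord c b ?Z i u \<ge> 0" by (rule coord_nonneg[OF Z Z_0[OF z]])
            have "- (car c ?l (letter b i) * coord c b ?Z i u) = (- car c ?l (letter b i)) * coord c b ?Z i u"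
              by simp
            also have "\<dots> \<le> 2 * coord c b ?Z i u"
              using nn car_bounds(1)[of ?l "letter b i"] by (intro mult_right_mono) auto
            also have "coord c b ?Z i u \<le> coord c b ?Z i (T + 1 + (2 * ?B + M * ?B))"
              using 2 by (intro coord_mono Z) auto
            also have "\<dots> = \<omega> i * (M * ?B)" by (rule M(2)[OF z that order_refl])
            finally show ?thesis by simp
          qed
          then have "(\<Sum>i<k. - (car c ?l (letter b i) * coord c b ?Z i u)) \<le> (\<Sum>i<k. 2 * (\<omega> i * M) * ?B)"
            by (intro sum_mono) auto
          moreover have "- stage c b ?Z k ?l u = w - 2 * ?B + (\<Sum>i<k. - (car c ?l (letter b i) * coord c b ?Z i u))"
            unfolding stage_eq using extend_after[OF w(1), of ?B T z ?l] w by (simp add: sum_negf)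
          moreover have "N * ?B = M * ?B + (\<Sum>i<k. 2 * (\<omega> i * M) * ?B)"
            unfolding N_def distrib_right sum_distrib_right ..
          ultimately have "- stage c b ?Z k ?l u \<le> N * ?B" using 2 unfolding w_def by linarith
          with Bv show ?thesis by simp
        next
          case 3
          define w where "w = u - (T + 1) - 2 * ?B"
          have "u = T + 1 + (2 * ?B + w)" "w \<ge> M * ?B" using 3 by (auto simp: w_def)
          moreover have "w \<le> v" using u z(3) B v0 by (auto simp: w_def)
          ultimately show ?thesis using late[of w] \<omega>k by simp
        qed
      qed
      show "\<omega> k * v \<le> coord c b ?Z k (T + 1 + (2 * ?B + v))"
        using coord_ge_stage[OF Z, of "T + 1 + (2 * ?B + v)" _ c b k] late[OF vM] z(3) B v0 by simp
    qed
  qed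
  show ?case
  proof (intro exI[of _ M'] conjI allI impI)
    show "M' \<ge> 0" using M'(1) M(1) by simp
    fix z :: "bool \<Rightarrow> real \<Rightarrow> real" and T b j v
    assume *: "cont2 z \<and> (\<forall>e. z e 0 = 0) \<and> T \<ge> 0" "j < Suc k" "v \<ge> M' * csum True z T"
    then have "v \<ge> M * csum True z T"
      using mult_right_mono[OF M'(1) csum_nonneg[of z T True]] by auto
    with * new M(2) show "coord c b (extend (csum True z T) T z) j (T + 1 + (2 * csum True z T + v)) = \<omega> j * v"
      by (cases "j = k") auto
  qed
qed

text \<open>All paths and end times are handled together as members of one set \<open>A\<close>;
  \<open>rep\<close> then yields a single function serving all of them.\<close>

theorem coord_change:
  "\<exists>\<phi>. \<forall>j<m. pl m (\<phi> j) \<and>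
    (\<forall>z T. cont2 z \<and> (\<forall>e. z e 0 = 0) \<and> T \<ge> 0 \<longrightarrow>
      coord c b' z j T = \<phi> j (\<lambda>i. coord c b z i T))"
proof -
  define A where "A = {(z :: bool \<Rightarrow> real \<Rightarrow> real, T :: real). cont2 z \<and> (\<forall>e. z e 0 = 0) \<and> T \<ge> 0}"
  define xs where "xs = (\<lambda>(z, T) i. coord c b z i T)"
  define S where "S = (\<lambda>(z, T). csum True z T)"
  define Y where "Y = (\<lambda>\<tau> :: (bool \<Rightarrow> real \<Rightarrow> real) \<times> real. extend (S \<tau>) (snd \<tau>) (fst \<tau>))"
  define t1 where "t1 = (\<lambda>\<tau> :: (bool \<Rightarrow> real \<Rightarrow> real) \<times> real. snd \<tau> + 1)"
  obtain M where M: "M \<ge> 0"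
    "\<And>z T b j v. \<lbrakk>cont2 z; \<And>e. z e 0 = 0; T \<ge> 0; j < m; v \<ge> M * csum True z T\<rbrakk> \<Longrightarrow>
      coord c b (extend (csum True z T) T z) j (T + 1 + (2 * csum True z T + v)) = \<omega> j * v"
    using coord_extend_eventually[OF order_refl] by auto
  \<comment> \<open>A horizon linear in the coordinates, at which each of them has reached its
    linear regime with \<open>v = M * S \<tau>\<close>.\<close>
  define H where "H = (\<lambda>\<tau>. (2 + M) * S \<tau>)"
  have A: "cont2 (fst \<tau>)" "\<And>e. fst \<tau> e 0 = 0" "snd \<tau> \<ge> 0" if "\<tau> \<in> A" for \<tau>
    using that by (auto simp: A_def)
  \<comment> \<open>Independence of the word turns \<open>S\<close>, defined by the word starting
    with \<open>True\<close>, into a linear function of the coordinates for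
    \<open>b\<close>.\<close>
  have S: "S \<tau> = (\<Sum>i<m. xs \<tau> i)" if "\<tau> \<in> A" for \<tau>
    using csum_indep[OF A[OF that], of True b] by (simp add: S_def xs_def csum_def split_beta)
  have S0: "S \<tau> \<ge> 0" if "\<tau> \<in> A" for \<tau>
    using csum_nonneg[OF A[OF that]] by (simp add: S_def split_beta)
  have Yc: "cont2 (Y \<tau>)" if "\<tau> \<in> A" for \<tau>
    unfolding Y_def by (rule extend_cont2[OF A(1)[OF that]])
  have Y_after: "Y \<tau> e (t1 \<tau> + v) = 2 * S \<tau> - v" if "0 \<le> v" for \<tau> e v
    using extend_after[OF that] by (simp add: Y_def t1_def)
  have coord_after: "coord c e (Y \<tau>) i (t1 \<tau> + v) =
      max (coord c e (fst \<tau>) i (snd \<tau>)) (SUP u\<in>{0..v}. - stage c e (Y \<tau>) i (letter e i) (t1 \<tau> + u))"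
    if "\<tau> \<in> A" "0 \<le> v" "i < m" for \<tau> e v i
    using coord_extend_after[OF A[OF that(1)] that(2,3)] by (simp add: Y_def t1_def S_def split_beta)
  have plS: "pl m (\<lambda>x. \<Sum>i<m. x i)" by (intro pl_sum pl_coord) auto
  have repS: "rep m A xs H (\<lambda>\<tau> v. k * S \<tau>)" for k
    by (rule rep_cong[OF rep_vector[OF pl_scale[OF plS, of k]]]) (simp add: S)
  have repY: "rep m A xs H (\<lambda>\<tau> v. Y \<tau> e (t1 \<tau> + v))" for e
    by (rule rep_cong[OF rep_add[OF repS[of 2] rep_scale[OF rep_time, of _ _ _ _ "-1"]]]) (simp add: Y_after)
  have forward: "rep m A xs H (\<lambda>\<tau> v. coord c b (Y \<tau>) i (t1 \<tau> + v))" if "i < m" for i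
    using that
  proof (induction i rule: less_induct)
    case (less i)
    have stage: "rep m A xs H (\<lambda>\<tau> v. stage c b (Y \<tau>) i (letter b i) (t1 \<tau> + v))"
      unfolding stage_eq using less by (intro rep_add repY rep_sum rep_scale) auto
    have "rep m A xs H (\<lambda>\<tau> v. max (xs \<tau> i) (SUP u\<in>{0..v}. (-1) * stage c b (Y \<tau>) i (letter b i) (t1 \<tau> + u)))"
      by (rule rep_max[OF rep_vector[OF pl_coord[OF less.prems]] rep_SUP_past[OF rep_scale[OF stage]]])
    then show ?case
      by (rule rep_cong) (simp add: coord_after less.prems xs_def split_beta)
  qed
  have tot: "rep m A xs H (\<lambda>\<tau> v. letter_total c b (Y \<tau>) m e (t1 \<tau> + v))" for e
    unfolding letter_total_def
  proof (rule rep_sum)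
    fix i assume "i \<in> {..<m}"
    then show "rep m A xs H (\<lambda>\<tau> v. if letter b i = e then coord c b (Y \<tau>) i (t1 \<tau> + v) else 0)"
      using forward by (cases "letter b i = e") (auto intro: rep_vector[OF pl_zero])
  qed
  have final: "rep m A xs H (\<lambda>\<tau> v. stage c b' (Y \<tau>) m a (t1 \<tau> + v))" for a
  proof -
    have "rep m A xs H (\<lambda>\<tau> v. stage c b (Y \<tau>) m a (t1 \<tau> + v))"
      unfolding stage_eq_letter_total by (intro rep_add repY rep_sum rep_scale tot)
    then show ?thesis
      by (rule rep_cong) (simp add: stage_eq_letter_total letter_total_braid[OF Yc, of _ b' _ _ b])
  qed
  have step: "rep m A xs H (\<lambda>\<tau> v. coord c b' (Y \<tau>) j (t1 \<tau> + v))"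
    if j: "j < m" and st: "rep m A xs H (\<lambda>\<tau> v. stage c b' (Y \<tau>) (Suc j) (letter b' j) (t1 \<tau> + v))" for j
  proof -
    \<comment> \<open>The first argument of \<open>min\<close> is the value of the coordinate at the
      horizon; the infimum is that of the inversion formula.\<close>
    have "rep m A xs H (\<lambda>\<tau> v. min ((\<omega> j * M) * S \<tau>)
        (INF u\<in>{v..H \<tau>}. stage c b' (Y \<tau>) (Suc j) (letter b' j) (t1 \<tau> + u)))"
      unfolding H_def
      by (intro rep_min rep_INF[OF st[unfolded H_def] rep_time] repS[unfolded H_def]) auto
    then show ?thesis
    proof (rule rep_cong)
      fix \<tau> v assume \<tau>: "\<tau> \<in> A" "0 \<le> v" "v \<le> H \<tau>"
      let ?f = "stage c b' (Y \<tau>) j (letter b' j)"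
      have "{t1 \<tau> + v..t1 \<tau> + H \<tau>} = (+) (t1 \<tau>) ` {v..H \<tau>}" by simp
      then have "(INF u\<in>{t1 \<tau> + v..t1 \<tau> + H \<tau>}. g u) = (INF u\<in>{v..H \<tau>}. g (t1 \<tau> + u))"
        for g :: "real \<Rightarrow> real" by (simp only: image_image)
      then have "(INF u\<in>{v..H \<tau>}. stage c b' (Y \<tau>) (Suc j) (letter b' j) (t1 \<tau> + u)) =
          (INF u\<in>{t1 \<tau> + v..t1 \<tau> + H \<tau>}. ?f u + 2 * rmax (\<lambda>u. - ?f u) u)"
        by (simp add: push_def car_def)
      moreover have "coord c b' (Y \<tau>) j (t1 \<tau> + H \<tau>) = \<omega> j * M * S \<tau>"
        using M(2)[OF A[OF \<tau>(1)] j order_refl, of b'] by (simp add: Y_def t1_def H_def S_def split_beta algebra_simps)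
      moreover have "0 \<le> t1 \<tau> + v" "t1 \<tau> + v \<le> t1 \<tau> + H \<tau>" using A(3)[OF \<tau>(1)] \<tau> by (auto simp: t1_def)
      ultimately show "coord c b' (Y \<tau>) j (t1 \<tau> + v) = min ((\<omega> j * M) * S \<tau>)
          (INF u\<in>{v..H \<tau>}. stage c b' (Y \<tau>) (Suc j) (letter b' j) (t1 \<tau> + u))"
        using rmax_from_future[of ?f "t1 \<tau> + v" "t1 \<tau> + H \<tau>"] cont2_stage[OF Yc[OF \<tau>(1)]]
        by (simp add: coord_def)
    qed
  qed
  \<comment> \<open>Going down in \<open>j\<close>, one transform is undone by subtracting its
    coordinate, which \<open>step\<close> recovers from the stage after it.\<close>
  have backward: "rep m A xs H (\<lambda>\<tau> v. stage c b' (Y \<tau>) j a (t1 \<tau> + v))" if "j \<le> m" for j a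
    using that
  proof (induction j arbitrary: a rule: inc_induct)
    case base
    show ?case by (rule final)
  next
    case (step j)
    have "rep m A xs H (\<lambda>\<tau> v. stage c b' (Y \<tau>) (Suc j) a (t1 \<tau> + v) +
        (- car c a (letter b' j)) * coord c b' (Y \<tau>) j (t1 \<tau> + v))"
      using step by (intro rep_add rep_scale \<open>\<And>j. _ \<Longrightarrow> _ \<Longrightarrow> rep m A xs H (\<lambda>\<tau> v. coord c b' (Y \<tau>) j (t1 \<tau> + v))\<close>) auto
    then show ?case by (rule rep_cong) (simp add: push_def coord_def)
  qed
  have "\<exists>\<phi>. pl m \<phi> \<and> (\<forall>z T. cont2 z \<and> (\<forall>e. z e 0 = 0) \<and> T \<ge> 0 \<longrightarrow>
      coord c b' z j T = \<phi> (\<lambda>i. coord c b z i T))" if j: "j < m" for j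
  proof -
    have "rep m A xs H (\<lambda>\<tau> v. coord c b' (Y \<tau>) j (t1 \<tau> + v))"
      using j by (intro step backward) auto
    then obtain g where g: "pl (Suc m) g"
      "\<And>\<tau> v. \<lbrakk>\<tau> \<in> A; 0 \<le> v; v \<le> H \<tau>\<rbrakk> \<Longrightarrow> coord c b' (Y \<tau>) j (t1 \<tau> + v) = g ((xs \<tau>)(m := v))"
      by (rule repE) blast
    show ?thesis
    \<comment> \<open>At \<open>v = 0\<close> the coordinates still have their values at
      \<open>T\<close>, so the time slot is filled with 0.\<close>
    proof (intro exI[of _ "\<lambda>x. g (x(m := 0))"] conjI allI impI)
      show "pl m (\<lambda>x. g (x(m := 0)))" by (rule pl_subst[OF g(1) pl_zero]) auto
      fix z :: "bool \<Rightarrow> real \<Rightarrow> real" and T :: real assume zT: "cont2 z \<and> (\<forall>e. z e 0 = 0) \<and> T \<ge> 0"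
      then have \<tau>: "(z, T) \<in> A" by (simp add: A_def)
      have "H (z, T) \<ge> 0" using S0[OF \<tau>] M(1) by (simp add: H_def)
      then have "coord c b' (Y (z, T)) j (t1 (z, T)) = g ((xs (z, T))(m := 0))"
        using g(2)[OF \<tau>, of 0] by simp
      then show "coord c b' z j T = g ((\<lambda>i. coord c b z i T)(m := 0))"
        using coord_extend_T1[of z T j b'] zT j by (simp add: Y_def t1_def S_def xs_def)
    qed
  qed
  then show ?thesis by metis
qed

end

section \<open>Matsumoto's theorem\<close>

primrec alternating :: "nat \<Rightarrow> 'w \<Rightarrow> 'w \<Rightarrow> 'w list" where
  "alternating 0 s t = []"
| "alternating (Suc n) s t = s # alternating n t s"

lemma length_alternating [simp]: "length (alternating n s t) = n"
  by (induction n arbitrary: s t) auto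

section \<open>Reflections of a word, the exchange condition and braid moves\<close>

context coxeter_system
begin

lemma gen_carrier: "s \<in> S \<Longrightarrow> s \<in> carrier W"
  using gens_closed by blast

lemma gen_square: "s \<in> S \<Longrightarrow> s \<otimes> s = \<one>"
  using involution by blast

lemma gen_inv: "s \<in> S \<Longrightarrow> inv s = s"
  using gen_square gen_carrier inv_equality by blast

lemma gen_cancel: "\<lbrakk>s \<in> S; x \<in> carrier W\<rbrakk> \<Longrightarrow> s \<otimes> (s \<otimes> x) = x"
  using gen_square gen_carrier by (simp add: m_assoc[symmetric])

lemma word_closed: "u \<in> lists S \<Longrightarrow> word_prod W u \<in> carrier W"
  by (induction u) (auto simp: gen_carrier)

lemma word_append:
  "\<lbrakk>u \<in> lists S; v \<in> lists S\<rbrakk> \<Longrightarrow> word_prod W (u @ v) = word_prod W u \<otimes> word_prod W v"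
  by (induction u) (auto simp: gen_carrier word_closed m_assoc simp del: foldr_append)

text \<open>For a word \<open>s1 s2 ... sp\<close> these are \<open>s1\<close>,
  \<open>s1 s2 s1\<close>, and so on; left multiplication by the \<open>i\<close>-th one deletes the
  \<open>i\<close>-th letter.\<close>

primrec reflections :: "'w list \<Rightarrow> 'w list" where
  "reflections [] = []"
| "reflections (s # u) = s # map (\<lambda>r. s \<otimes> r \<otimes> s) (reflections u)"

lemma length_reflections [simp]: "length (reflections u) = length u"
  by (induction u) auto

lemma reflections_carrier: "u \<in> lists S \<Longrightarrow> r \<in> set (reflections u) \<Longrightarrow> r \<in> carrier W"
  by (induction u arbitrary: r) (auto simp: gen_carrier)

lemma reflections_square: "u \<in> lists S \<Longrightarrow> r \<in> set (reflections u) \<Longrightarrow> r \<otimes> r = \<one>"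
proof (induction u arbitrary: r)
  case (Cons s u)
  show ?case
  proof (cases "r = s")
    case False
    with Cons.prems obtain q where q: "q \<in> set (reflections u)" "r = s \<otimes> q \<otimes> s" by auto
    have "s \<in> S" "s \<in> carrier W" "q \<in> carrier W" "q \<otimes> q = \<one>"
      using Cons q reflections_carrier by (auto simp: gen_carrier)
    then show ?thesis
      using gen_cancel[of s "q \<otimes> s"] gen_square
      by (simp add: q(2) m_assoc) (simp add: m_assoc[symmetric])
  qed (use Cons.prems gen_square in auto)
qed auto

lemma reflections_append:
  assumes "u \<in> lists S" "v \<in> lists S"
  shows "reflections (u @ v) =
    reflections u @ map (\<lambda>r. word_prod W u \<otimes> r \<otimes> inv (word_prod W u)) (reflections v)"
  using assms(1)
proof (induction u)
  case Nil
  have "map (\<lambda>r. \<one> \<otimes> r \<otimes> inv \<one>) (reflections v) = reflections v"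
    using reflections_carrier[OF assms(2)] by (intro map_idI) auto
  then show ?case by simp
next
  case (Cons s u)
  then have s: "s \<in> S" "s \<in> carrier W" "word_prod W u \<in> carrier W"
    by (auto simp: gen_carrier word_closed)
  have "s \<otimes> (word_prod W u \<otimes> r \<otimes> inv (word_prod W u)) \<otimes> s =
      s \<otimes> word_prod W u \<otimes> r \<otimes> inv (s \<otimes> word_prod W u)" if "r \<in> set (reflections v)" for r
    using s reflections_carrier[OF assms(2) that] gen_inv by (simp add: inv_mult_group m_assoc)
  with Cons show ?case by simp
qed

lemma reflection_mult:
  assumes "u \<in> lists S" "i < length u"
  shows "reflections u ! i \<otimes> word_prod W u = word_prod W (take i u @ drop (Suc i) u)"
  using assms
proof (induction u arbitrary: i)
  case (Cons s u)
  then have s: "s \<in> S" "s \<in> carrier W" "word_prod W u \<in> carrier W"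
    by (auto simp: gen_carrier word_closed)
  show ?case
  proof (cases i)
    case 0
    with s show ?thesis by (simp add: gen_cancel)
  next
    case (Suc j)
    then have j: "j < length u" using Cons.prems by simp
    have u: "u \<in> lists S" using Cons by auto
    have q: "reflections u ! j \<in> carrier W"
      by (rule reflections_carrier[OF u]) (use j in simp)
    have "s \<otimes> (reflections u ! j) \<otimes> s \<otimes> (s \<otimes> word_prod W u) = s \<otimes> (reflections u ! j \<otimes> word_prod W u)"
      using s q by (simp add: m_assoc gen_cancel)
    with Suc Cons j show ?thesis by simp
  qed
qed simp

lemma pow_shift:
  assumes "s \<in> carrier W" "t \<in> carrier W"
  shows "s \<otimes> (t \<otimes> s) [^] (n :: nat) = (s \<otimes> t) [^] n \<otimes> s"
proof (induction n)
  case (Suc n)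
  have "s \<otimes> (t \<otimes> s) [^] Suc n = s \<otimes> (t \<otimes> s) [^] n \<otimes> (t \<otimes> s)"
    using assms by (simp add: m_assoc)
  also have "\<dots> = (s \<otimes> t) [^] Suc n \<otimes> s" unfolding Suc using assms by (simp add: m_assoc)
  finally show ?case .
qed (use assms in simp)

lemma reflections_alternating:
  assumes "s \<in> S" "t \<in> S"
  shows "reflections (alternating n s t) = map (\<lambda>j. (s \<otimes> t) [^] j \<otimes> s) [0..<n]"
  using assms
proof (induction n arbitrary: s t)
  case (Suc n)
  then have st: "s \<in> carrier W" "t \<in> carrier W" by (auto simp: gen_carrier)
  have "s \<otimes> ((t \<otimes> s) [^] j \<otimes> t) \<otimes> s = (s \<otimes> t) [^] Suc j \<otimes> s" for j
    using pow_shift[OF st, of j] st by (simp add: m_assoc[symmetric]) 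
  then show ?case
    using Suc st by (simp add: map_upt_Suc del: upt_Suc nat_pow_Suc)
qed simp

lemma alternating_lists: "\<lbrakk>s \<in> S; t \<in> S\<rbrakk> \<Longrightarrow> alternating n s t \<in> lists S"
  by (induction n arbitrary: s t) auto

lemma alternating_double: "concat (replicate n [s, t]) = alternating (2 * n) s t"
  by (induction n) auto

lemma word_alternating_double:
  assumes "s \<in> S" "t \<in> S"
  shows "word_prod W (alternating (2 * n) s t) = (s \<otimes> t) [^] n"
proof (induction n)
  case (Suc n)
  have "(s \<otimes> t) \<otimes> (s \<otimes> t) [^] n = (s \<otimes> t) [^] Suc n"
    by (rule nat_pow_Suc2[symmetric]) (use assms in \<open>simp add: gen_carrier\<close>)
  with Suc assms show ?case by (simp add: m_assoc gen_carrier del: nat_pow_Suc)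
qed simp

text \<open>At \<open>n = cox_m W s t\<close> the power is trivial and the braid relation
  results.\<close>

lemma word_alternating_swap:
  assumes "s \<in> S" "t \<in> S"
  shows "word_prod W (alternating n s t) = (s \<otimes> t) [^] n \<otimes> word_prod W (alternating n t s)"
  using assms
proof (induction n arbitrary: s t)
  case (Suc n)
  let ?v = "word_prod W (alternating n s t)"
  have st: "s \<in> carrier W" "t \<in> carrier W" "?v \<in> carrier W"
    using Suc.prems by (auto simp: gen_carrier word_closed alternating_lists)
  have "word_prod W (alternating (Suc n) s t) = s \<otimes> (t \<otimes> s) [^] n \<otimes> ?v"
    unfolding alternating.simps foldr_Cons o_apply Suc.IH[OF Suc.prems(2,1)]
    using st by (simp add: m_assoc)
  also have "\<dots> = (s \<otimes> t) [^] n \<otimes> s \<otimes> ?v" using pow_shift[OF st(1,2)] by simp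
  also have "\<dots> = (s \<otimes> t) [^] n \<otimes> s \<otimes> (t \<otimes> (t \<otimes> ?v))"
    using Suc.prems st by (simp add: gen_cancel)
  also have "\<dots> = (s \<otimes> t) [^] Suc n \<otimes> word_prod W (alternating (Suc n) t s)"
    using st by (simp add: m_assoc)
  finally show ?case .
qed simp

lemma pow_cox_m: "\<lbrakk>s \<in> S; t \<in> S\<rbrakk> \<Longrightarrow> (s \<otimes> t) [^] cox_m W s t = \<one>"
  unfolding cox_m_def by (intro pow_ord_eq_1) (simp add: gen_carrier)

lemma cox_m_sym:
  assumes "s \<in> S" "t \<in> S"
  shows "cox_m W s t = cox_m W t s"
proof -
  have "t \<otimes> s = inv (s \<otimes> t)" using assms by (simp add: inv_mult_group gen_carrier gen_inv)
  then show ?thesis unfolding cox_m_def using assms by (simp add: ord_inv gen_carrier)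
qed

text \<open>The reflections of a relator \<open>(s t)\<^sup>m\<close> come in a list that is repeated twice.\<close>
lemma even_count_reflections_cong:
  assumes "cox_cong W S u v"
  shows "even (count_list (reflections u) r) = even (count_list (reflections v) r)"
  using assms
proof induction
  case (rel u v s t)
  let ?m = "cox_m W s t"
  let ?d = "alternating (2 * ?m) s t"
  have d: "?d \<in> lists S" "word_prod W ?d = \<one>"
    using rel alternating_lists[of s t] by (auto simp: word_alternating_double pow_cox_m)
  let ?f = "\<lambda>j. (s \<otimes> t) [^] j \<otimes> s"
  have per: "(s \<otimes> t) [^] (?m + j) = (s \<otimes> t) [^] j" for j
    using rel pow_cox_m by (simp add: gen_carrier nat_pow_mult[symmetric])
  have "map ?f [0..<?m + ?m] = map ?f [0..<?m] @ map ?f [?m..<?m + ?m]"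
    by (simp only: upt_add_eq_append[OF le0] map_append)
  also have "map ?f [?m..<?m + ?m] = map ?f [0..<?m]"
    by (rule nth_equalityI) (simp_all add: per)
  finally have "reflections ?d = reflections (alternating ?m s t) @ reflections (alternating ?m s t)"
    unfolding reflections_alternating[OF rel(3,4)] mult_2 .
  \<comment> \<open>The relator has product one, so conjugation by it leaves the reflections of
    \<open>v\<close> as they are.\<close>
  moreover have "reflections (?d @ v) = reflections ?d @ reflections v"
    using reflections_append[OF d(1) rel(2)] reflections_carrier[OF rel(2)]
    unfolding d(2) by (simp cong: map_cong)
  moreover have "?d @ v \<in> lists S" using d rel by auto
  ultimately show ?case
    using reflections_append[OF rel(1)] rel(2)
    by (simp add: alternating_double del: reflections.simps) blast
qed simp_all

lemma reduced_le:
  assumes "reduced_decomposition W S u w" "v \<in> lists S" "word_prod W v = w"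
  shows "length u \<le> length v"
  using assms unfolding reduced_decomposition_def cox_length_def by (auto intro: Least_le)

lemma reducedI:
  assumes "reduced_decomposition W S u w" "v \<in> lists S" "word_prod W v = w" "length v = length u"
  shows "reduced_decomposition W S v w"
  using assms unfolding reduced_decomposition_def by auto

text \<open>Two equal reflections cancel as involutions, so deleting both letters would give a
  shorter word for the same element.\<close>

lemma reduced_distinct_reflections:
  assumes u: "reduced_decomposition W S u w"
  shows "distinct (reflections u)"
proof (rule ccontr)
  have uS: "u \<in> lists S" "word_prod W u = w" using u by (auto simp: reduced_decomposition_def)
  assume "\<not> distinct (reflections u)"
  then obtain i j where ij: "i < j" "j < length u" "reflections u ! i = reflections u ! j"
    by (auto simp: distinct_conv_nth) (metis linorder_neqE_nat)
  \<comment> \<open>Deleting the later letter first leaves the prefix, and with it the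
    \<open>i\<close>-th reflection, untouched.\<close>
  define u' where "u' = take j u @ drop (Suc j) u"
  have u': "u' \<in> lists S" using uS by (auto simp: u'_def dest: in_set_takeD in_set_dropD)
  have "reflections u' ! i = reflections u ! i"
  proof -
    have "take j u \<in> lists S" "drop j u \<in> lists S" "drop (Suc j) u \<in> lists S"
      using uS by (auto dest: in_set_takeD in_set_dropD)
    then have "reflections u' ! i = reflections (take j u) ! i"
      "reflections (take j u @ drop j u) ! i = reflections (take j u) ! i"
      using ij by (auto simp: u'_def reflections_append nth_append simp del: append_take_drop_id)
    then show ?thesis by simp
  qed
  moreover have "reflections u ! i \<otimes> (reflections u ! j \<otimes> word_prod W u) = w"
  proof -
    have "reflections u ! i \<in> set (reflections u)" using ij by simp
    then have "reflections u ! i \<in> carrier W" "reflections u ! i \<otimes> reflections u ! i = \<one>"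
      using reflections_carrier reflections_square uS by auto
    then show ?thesis
      using ij uS word_closed[OF uS(1)] by (simp add: m_assoc[symmetric])
  qed
  ultimately have "word_prod W (take i u' @ drop (Suc i) u') = w"
    using reflection_mult[OF uS(1) ij(2)] reflection_mult[OF u', of i] ij by (simp add: u'_def)
  moreover have "take i u' @ drop (Suc i) u' \<in> lists S"
    using u' by (auto dest: in_set_takeD in_set_dropD)
  ultimately show False
    using reduced_le[OF u, of "take i u' @ drop (Suc i) u'"] ij by (simp add: u'_def)
qed

text \<open>The parity of the multiplicity of \<open>s\<close> among the reflections depends only on
  \<open>w\<close>. In the reduced word \<open>s # v\<close> the multiplicity is 1, so it is odd in
  \<open>u\<close> as well.\<close>

lemma exchange:
  assumes u: "reduced_decomposition W S u w" and v: "reduced_decomposition W S (s # v) w"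
  obtains i where "i < length u" "reflections u ! i = s"
proof -
  have "cox_cong W S u (s # v)"
    using u v by (intro presentation) (auto simp: reduced_decomposition_def)
  from even_count_reflections_cong[OF this, of s]
  have "even (count_list (reflections u) s) = even (count_list (reflections (s # v)) s)" .
  moreover have "count_list (reflections (s # v)) s = 1"
    using reduced_distinct_reflections[OF v] by (simp add: count_list_0_iff)
  ultimately have "count_list (reflections u) s \<noteq> 0" by (metis even_zero odd_one)
  then have "s \<in> set (reflections u)" by (metis count_notin)
  with that show thesis by (auto simp: in_set_conv_nth)
qed

text \<open>As \<open>w\<close> has reduced words starting with either letter, the exchange
  condition can put the other letter in front of an alternating prefix; the letter deleted in return
  lies behind the prefix as long as this is shorter than \<open>cox_m W s t\<close>.\<close>

lemma reduced_alternating_prefix: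
  assumes s: "reduced_decomposition W S (s # u) w" and t: "reduced_decomposition W S (t # v) w"
    and k: "0 < k" "k \<le> cox_m W s t"
  shows "\<exists>x y r. (x, y) \<in> {(s, t), (t, s)} \<and> reduced_decomposition W S (alternating k x y @ r) w"
  using k
proof (induction k rule: nat_induct_non_zero)
  case 1
  show ?case using s by (intro exI[of _ s] exI[of _ t] exI[of _ u]) simp
next
  case (Suc k)
  then obtain x y r where xy: "(x, y) \<in> {(s, t), (t, s)}"
    and red: "reduced_decomposition W S (alternating k x y @ r) w" by auto
  let ?a = "alternating k x y @ r"
  have S: "s \<in> S" "t \<in> S" "x \<in> S" "y \<in> S" using s t xy by (auto simp: reduced_decomposition_def)
  have a: "?a \<in> lists S" "word_prod W ?a = w" using red by (auto simp: reduced_decomposition_def)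
  obtain v' where "reduced_decomposition W S (y # v') w" using s t xy by auto
  from exchange[OF red this] obtain i where i: "i < length ?a" "reflections ?a ! i = y" .
  \<comment> \<open>A deletion inside the prefix would mean \<open>(x y)^i x = y\<close>, so the
    order of \<open>x y\<close> would be at most \<open>i + 1 \<le> k\<close>.\<close>
  have "k \<le> i"
  proof (rule ccontr)
    assume "\<not> k \<le> i"
    then have ik: "i < k" by simp
    then have "(x \<otimes> y) [^] i \<otimes> x = y"
      using i S a alternating_lists[of x y k]
      by (simp add: reflections_append nth_append reflections_alternating)
    then have "(x \<otimes> y) [^] Suc i = \<one>"
      using S gen_square by (simp add: gen_carrier m_assoc[symmetric])
    then have "ord (x \<otimes> y) dvd Suc i" using S pow_eq_id[of "x \<otimes> y" "Suc i"] by (simp add: gen_carrier)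
    then have "cox_m W x y \<le> Suc i" unfolding cox_m_def by (rule dvd_imp_le) simp
    moreover have "cox_m W x y = cox_m W s t" using xy cox_m_sym[OF S(1,2)] by auto
    ultimately show False using ik Suc.prems by simp
  qed
  define r' where "r' = take (i - k) r @ drop (Suc i - k) r"
  have del: "take i ?a @ drop (Suc i) ?a = alternating k x y @ r'"
    using \<open>k \<le> i\<close> by (simp add: r'_def)
  have r'S: "r' \<in> lists S" using a by (auto simp: r'_def dest: in_set_takeD in_set_dropD)
  have "y \<otimes> w = word_prod W (alternating k x y @ r')"
    using reflection_mult[OF a(1) i(1)] i(2) a(2) unfolding del by simp
  then have "w = word_prod W (alternating (Suc k) y x @ r')"
    using gen_cancel[OF S(4), of w] word_closed[OF a(1)] a(2) by simp
  moreover have "alternating (Suc k) y x @ r' \<in> lists S"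
    using alternating_lists[OF S(4,3), of "Suc k"] r'S by (simp only: append_in_lists_conv)
  moreover have "length (alternating (Suc k) y x @ r') = length ?a"
    using i \<open>k \<le> i\<close> by (auto simp: r'_def)
  ultimately have "reduced_decomposition W S (alternating (Suc k) y x @ r') w"
    using reducedI[OF red] by metis
  then show ?case using xy by blast
qed

text \<open>If the first letters differ, the two versions of a full alternating prefix form a
  bridge: one shares its first letter with \<open>u\<close>, the other with \<open>v\<close>, and a
  braid move joins them. Words with a common first letter reduce to shorter ones by cancelling
  it.\<close>

theorem matsumoto:
  assumes fin: "\<And>s t. \<lbrakk>s \<in> S; t \<in> S; s \<noteq> t\<rbrakk> \<Longrightarrow> cox_m W s t > 0"
    and nil: "E [] []"
    and trans: "\<And>u v x. \<lbrakk>E u v; E v x\<rbrakk> \<Longrightarrow> E u x"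
    and Cons: "\<And>s u v. \<lbrakk>s \<in> S; E u v\<rbrakk> \<Longrightarrow> E (s # u) (s # v)"
    and braid: "\<And>s t u. \<lbrakk>s \<in> S; t \<in> S; s \<noteq> t; u \<in> lists S\<rbrakk> \<Longrightarrow>
      E (alternating (cox_m W s t) s t @ u) (alternating (cox_m W s t) t s @ u)"
    and u: "reduced_decomposition W S u w" and v: "reduced_decomposition W S v w"
  shows "E u v"
  using u v
proof (induction "length u" arbitrary: u v w)
  case 0
  then show ?case using nil by (auto simp: reduced_decomposition_def)
next
  case (Suc n)
  have len: "length v = Suc n" using Suc by (simp add: reduced_decomposition_def)
  have same: "E (s # a) (s # b)"
    if "reduced_decomposition W S (s # a) w" "reduced_decomposition W S (s # b) w" "length a = n" for s a b w
  proof -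
    have ab: "s \<in> S" "a \<in> lists S" "b \<in> lists S" "length b = length a"
      "word_prod W (s # a) = w" "word_prod W (s # b) = w"
      using that by (auto simp: reduced_decomposition_def)
    have eq: "word_prod W a = word_prod W b"
      using ab gen_cancel[of s "word_prod W a"] gen_cancel[of s "word_prod W b"] word_closed by auto
    have min: "length a \<le> length c" if "c \<in> lists S" "word_prod W c = word_prod W a" for c
      using reduced_le[OF \<open>reduced_decomposition W S (s # a) w\<close>, of "s # c"] ab that by simp
    have "cox_length W S (word_prod W a) = length a"
      unfolding cox_length_def by (rule Least_equality) (use ab min in auto)
    then have "reduced_decomposition W S a (word_prod W a)" "reduced_decomposition W S b (word_prod W a)"
      using ab eq by (auto simp: reduced_decomposition_def)
    with Suc.hyps(1)[of a] that(3) show ?thesis using Cons ab(1) by blast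
  qed
  obtain s a where sa: "u = s # a" "length a = n" using Suc.hyps(2) by (cases u) auto
  obtain t b where tb: "v = t # b" "length b = n" using len by (cases v) auto
  have st: "s \<in> S" "t \<in> S" using Suc.prems sa tb by (auto simp: reduced_decomposition_def)
  show ?case
  proof (cases "s = t")
    case True
    then show ?thesis using same Suc.prems sa tb by blast
  next
    case False
    let ?m = "cox_m W s t"
    have m0: "?m > 0" by (rule fin[OF st False])
    obtain x y r where xy: "(x, y) \<in> {(s, t), (t, s)}"
      and red: "reduced_decomposition W S (alternating ?m x y @ r) w"
      using reduced_alternating_prefix[of s a w t b ?m] Suc.prems sa tb m0 by blast
    have r: "r \<in> lists S" "word_prod W (alternating ?m x y @ r) = w"
      using red by (auto simp: reduced_decomposition_def)
    have swap: "word_prod W (alternating ?m s t) = word_prod W (alternating ?m t s)"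
      using word_alternating_swap[OF st, of ?m] pow_cox_m[OF st] st
      by (simp add: word_closed alternating_lists)
    have prods: "word_prod W (alternating ?m s t @ r) = w" "word_prod W (alternating ?m t s @ r) = w"
      using r xy swap word_append[OF alternating_lists[OF st] r(1)]
        word_append[OF alternating_lists[OF st(2,1)] r(1)]
      by (auto simp del: foldr_append)
    have reds: "reduced_decomposition W S (alternating ?m s t @ r) w"
      "reduced_decomposition W S (alternating ?m t s @ r) w"
      using r(1) st prods
      by (intro reducedI[OF red]; simp add: alternating_lists del: foldr_append)+
    obtain k where k: "?m = Suc k" using m0 by (cases ?m) auto
    have lens: "length (alternating ?m s t @ r) = Suc n" "length (alternating ?m t s @ r) = Suc n"
      using reds Suc.prems Suc.hyps(2) by (auto simp: reduced_decomposition_def)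
    have "E (s # a) (alternating ?m s t @ r)"
      using same[of s a w "alternating k t s @ r"] Suc.prems reds(1) sa by (simp add: k)
    moreover have "E (alternating ?m s t @ r) (alternating ?m t s @ r)"
      by (rule braid[OF st False r(1)])
    moreover have "E (alternating ?m t s @ r) (t # b)"
      using same[of t "alternating k s t @ r" w b] Suc.prems reds(2) tb lens by (simp add: k)
    ultimately show ?thesis unfolding sa tb using trans by blast
  qed
qed

end

section \<open>Coordinates along braid moves\<close>

lemma path_coords_append:
  "path_coords \<alpha> \<alpha>v T (us @ vs) \<eta> i = (if i < length us
    then path_coords \<alpha> \<alpha>v T us (foldr (path_transform \<alpha> \<alpha>v) vs \<eta>) i
    else path_coords \<alpha> \<alpha>v T vs \<eta> (i - length us))"
  by (auto simp: path_coords_def partial_path_def nth_append Suc_diff_le)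

lemma path_coords_Cons:
  "path_coords \<alpha> \<alpha>v T (s # us) \<eta> i = (case i of
      0 \<Rightarrow> - (INF t\<in>{0..T}. \<alpha>v s (foldr (path_transform \<alpha> \<alpha>v) us \<eta> t))
    | Suc j \<Rightarrow> path_coords \<alpha> \<alpha>v T us \<eta> j)"
  by (auto simp: path_coords_def partial_path_def split: nat.split)

lemma foldr_transform_local:
  assumes "\<And>t. t \<in> {0..T} \<Longrightarrow> \<eta> t = \<eta>' t" "t \<in> {0..T}"
  shows "foldr (path_transform \<alpha> \<alpha>v) us \<eta> t = foldr (path_transform \<alpha> \<alpha>v) us \<eta>' t"
  using assms(2)
proof (induction us arbitrary: t)
  case (Cons s us)
  have "(INF u\<in>{0..t}. \<alpha>v s (foldr (path_transform \<alpha> \<alpha>v) us \<eta> u)) =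
      (INF u\<in>{0..t}. \<alpha>v s (foldr (path_transform \<alpha> \<alpha>v) us \<eta>' u))"
    using Cons by (intro INF_cong) auto
  with Cons show ?case by (simp add: path_transform_def)
qed (simp add: assms(1))

text \<open>A constant continuation on both sides, as the facts about \<open>rmax\<close> require
  continuity on the whole line.\<close>

definition clamp_path :: "real \<Rightarrow> (real \<Rightarrow> 'v::euclidean_space) \<Rightarrow> real \<Rightarrow> 'v"
  where "clamp_path T \<eta> t = \<eta> (max 0 (min T t))"

lemma clamp_path_eq: "t \<in> {0..T} \<Longrightarrow> clamp_path T \<eta> t = \<eta> t"
  by (simp add: clamp_path_def)

lemma clamp_path_continuous:
  assumes "\<eta> \<in> paths0 T" "T \<ge> 0"
  shows "continuous_on UNIV (clamp_path T \<eta>)"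
  unfolding clamp_path_def
proof (rule continuous_on_compose2[of "{0..T}" \<eta>])
  show "continuous_on {0..T} \<eta>" using assms(1) by (simp add: paths0_def)
  show "continuous_on UNIV (\<lambda>t. max 0 (min T t))" by (intro continuous_intros)
qed (use assms(2) in auto)

lemma INF_eq_rmax:
  assumes "t \<in> {0..T}"
  shows "(INF u\<in>{0..t}. f (\<eta> u)) = - rmax (\<lambda>u. - f (clamp_path T \<eta> u)) t"
proof -
  have "rmax (\<lambda>u. - f (clamp_path T \<eta> u)) t = (SUP u\<in>{0..t}. - f (\<eta> u))"
    unfolding rmax_def
  proof (rule SUP_cong)
    show "{0..max 0 t} = {0..t}" using assms by simp
    show "- f (clamp_path T \<eta> u) = - f (\<eta> u)" if "u \<in> {0..t}" for u
      using that assms by (subst clamp_path_eq) simp_all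
  qed
  then show ?thesis by (simp add: Inf_real_def image_image)
qed

context finite_coxeter_realization
begin

abbreviation P :: "'w list \<Rightarrow> (real \<Rightarrow> 'v) \<Rightarrow> real \<Rightarrow> 'v"
  where "P us \<eta> \<equiv> foldr (path_transform \<alpha> \<alpha>v) us \<eta>"

abbreviation coords :: "real \<Rightarrow> 'w list \<Rightarrow> (real \<Rightarrow> 'v) \<Rightarrow> nat \<Rightarrow> real"
  where "coords T us \<eta> \<equiv> path_coords \<alpha> \<alpha>v T us \<eta>"

lemma coroot_continuous: "s \<in> S \<Longrightarrow> continuous_on A (\<alpha>v s)"
  using linear_coroot linear_continuous_on linear_conv_bounded_linear by blast

lemma coroot_clamp_continuous:
  assumes "s \<in> S" "\<eta> \<in> paths0 T" "T \<ge> 0"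
  shows "continuous_on UNIV (\<lambda>t. \<alpha>v s (clamp_path T \<eta> t))"
  by (rule continuous_on_compose2[OF coroot_continuous[OF assms(1), of UNIV]
        clamp_path_continuous[OF assms(2,3)]]) simp

lemma transform_eq:
  assumes "t \<in> {0..T}"
  shows "path_transform \<alpha> \<alpha>v s \<eta> t = \<eta> t + rmax (\<lambda>u. - \<alpha>v s (clamp_path T \<eta> u)) t *\<^sub>R \<alpha> s"
  unfolding path_transform_def INF_eq_rmax[OF assms, of "\<alpha>v s" \<eta>] by simp

lemma transform_paths0:
  assumes "s \<in> S" "\<eta> \<in> paths0 T" "T \<ge> 0"
  shows "path_transform \<alpha> \<alpha>v s \<eta> \<in> paths0 T"
proof -
  have "continuous_on {0..T} (\<lambda>t. \<eta> t + rmax (\<lambda>u. - \<alpha>v s (clamp_path T \<eta> u)) t *\<^sub>R \<alpha> s)"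
    using assms(2) coroot_clamp_continuous[OF assms]
    by (intro continuous_intros continuous_on_subset[OF rmax_continuous]) (auto simp: paths0_def)
  also have "?this \<longleftrightarrow> continuous_on {0..T} (path_transform \<alpha> \<alpha>v s \<eta>)"
    by (intro continuous_on_cong HOL.refl transform_eq[symmetric])
  finally have "continuous_on {0..T} (path_transform \<alpha> \<alpha>v s \<eta>)" .
  moreover have "path_transform \<alpha> \<alpha>v s \<eta> 0 = 0"
    using assms linear_0[OF linear_coroot[OF assms(1)]] by (simp add: path_transform_def paths0_def)
  ultimately show ?thesis by (simp add: paths0_def)
qed

lemma P_paths0: "\<lbrakk>us \<in> lists S; \<eta> \<in> paths0 T; T \<ge> 0\<rbrakk> \<Longrightarrow> P us \<eta> \<in> paths0 T"
  by (induction us) (auto intro: transform_paths0)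

text \<open>Equality of the transforms is included to make the relation stable under prepending a
  letter, whose coordinate is read off from the transformed path.\<close>

definition equiv_words :: "real \<Rightarrow> 'w list \<Rightarrow> 'w list \<Rightarrow> bool" where
  "equiv_words T u v \<longleftrightarrow> length u = length v \<and>
    (\<exists>f. \<forall>i<length u. pl (length u) (f i) \<and> (\<forall>\<eta>\<in>paths0 T. coords T v \<eta> i = f i (coords T u \<eta>))) \<and>
    (\<forall>\<eta>\<in>paths0 T. \<forall>t\<in>{0..T}. P u \<eta> t = P v \<eta> t)"

lemma equiv_words_trans:
  assumes "equiv_words T u v" "equiv_words T v w"
  shows "equiv_words T u w"
proof -
  let ?n = "length u"
  have len: "length v = ?n" "length w = ?n" using assms by (auto simp: equiv_words_def)
  obtain f where f: "\<And>i. i < ?n \<Longrightarrow> pl ?n (f i)"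
    "\<And>i \<eta>. \<lbrakk>i < ?n; \<eta> \<in> paths0 T\<rbrakk> \<Longrightarrow> coords T v \<eta> i = f i (coords T u \<eta>)"
    using assms(1) unfolding equiv_words_def by blast
  obtain g where g: "\<And>i. i < ?n \<Longrightarrow> pl ?n (g i)"
    "\<And>i \<eta>. \<lbrakk>i < ?n; \<eta> \<in> paths0 T\<rbrakk> \<Longrightarrow> coords T w \<eta> i = g i (coords T v \<eta>)"
    using assms(2) len unfolding equiv_words_def by metis
  show ?thesis
    unfolding equiv_words_def
  proof (intro conjI exI[of _ "\<lambda>i x. g i (\<lambda>j. f j x)"] allI impI ballI)
    fix i assume i: "i < ?n"
    show "pl ?n (\<lambda>x. g i (\<lambda>j. f j x))" by (rule pl_comp[OF g(1)[OF i] f(1)])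
    fix \<eta> :: "real \<Rightarrow> 'v" assume \<eta>: "\<eta> \<in> paths0 T"
    have "g i (coords T v \<eta>) = g i (\<lambda>j. f j (coords T u \<eta>))"
      by (rule pl_cong_arg[OF g(1)[OF i]]) (simp add: f(2) \<eta>)
    then show "coords T w \<eta> i = g i (\<lambda>j. f j (coords T u \<eta>))" by (simp add: g(2) i \<eta>)
  qed (use assms len in \<open>auto simp: equiv_words_def\<close>)
qed

lemma equiv_words_Cons:
  assumes "equiv_words T u v"
  shows "equiv_words T (s # u) (s # v)"
proof -
  let ?n = "length u"
  have len: "length v = ?n" and eq: "\<And>\<eta> t. \<lbrakk>\<eta> \<in> paths0 T; t \<in> {0..T}\<rbrakk> \<Longrightarrow> P v \<eta> t = P u \<eta> t"
    using assms by (auto simp: equiv_words_def)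
  obtain f where f: "\<And>i. i < ?n \<Longrightarrow> pl ?n (f i)"
    "\<And>i \<eta>. \<lbrakk>i < ?n; \<eta> \<in> paths0 T\<rbrakk> \<Longrightarrow> coords T v \<eta> i = f i (coords T u \<eta>)"
    using assms unfolding equiv_words_def by blast
  define g where "g = (\<lambda>i x. case i of 0 \<Rightarrow> x 0 | Suc j \<Rightarrow> f j (\<lambda>k. x (Suc k)))"
  show ?thesis
    unfolding equiv_words_def
  proof (intro conjI exI[of _ g] allI impI ballI)
    fix i assume i: "i < length (s # u)"
    show "pl (length (s # u)) (g i)"
    proof (cases i)
      case (Suc j)
      have "pl (length (s # u)) (\<lambda>x. f j (\<lambda>k. x (Suc k)))"
        by (rule pl_comp[OF f(1)]) (use i Suc in \<open>auto intro: pl_coord\<close>)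
      then show ?thesis by (simp add: Suc g_def)
    qed (simp add: g_def pl_coord)
    fix \<eta> :: "real \<Rightarrow> 'v" assume \<eta>: "\<eta> \<in> paths0 T"
    have "(INF t\<in>{0..T}. \<alpha>v s (P v \<eta> t)) = (INF t\<in>{0..T}. \<alpha>v s (P u \<eta> t))"
      using eq[OF \<eta>] by (intro INF_cong) auto
    then show "coords T (s # v) \<eta> i = g i (coords T (s # u) \<eta>)"
      using i f(2)[OF _ \<eta>] by (cases i) (auto simp: path_coords_Cons g_def)
  next
    fix \<eta> :: "real \<Rightarrow> 'v" and t :: real assume \<eta>: "\<eta> \<in> paths0 T" and t: "t \<in> {0..T}"
    show "P (s # u) \<eta> t = P (s # v) \<eta> t"
      using foldr_transform_local[of T "P u \<eta>" "P v \<eta>" t \<alpha> \<alpha>v "[s]"] eq[OF \<eta>] t by simp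
  qed (use len in simp)
qed

text \<open>The suffix acts first, so the relation is applied to the path \<open>P r \<eta>\<close>,
  and the coordinates of the suffix are common to both words.\<close>

lemma equiv_words_append:
  assumes "equiv_words T u v" "r \<in> lists S" "T \<ge> 0"
  shows "equiv_words T (u @ r) (v @ r)"
proof -
  let ?n = "length u" and ?k = "length (u @ r)"
  have len: "length v = ?n" and eq: "\<And>\<eta> t. \<lbrakk>\<eta> \<in> paths0 T; t \<in> {0..T}\<rbrakk> \<Longrightarrow> P v \<eta> t = P u \<eta> t"
    using assms by (auto simp: equiv_words_def)
  obtain f where f: "\<And>i. i < ?n \<Longrightarrow> pl ?n (f i)"
    "\<And>i \<eta>. \<lbrakk>i < ?n; \<eta> \<in> paths0 T\<rbrakk> \<Longrightarrow> coords T v \<eta> i = f i (coords T u \<eta>)"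
    using assms(1) unfolding equiv_words_def by blast
  define g where "g = (\<lambda>i x. if i < ?n then f i x else x i)"
  show ?thesis
    unfolding equiv_words_def
  proof (intro conjI exI[of _ g] allI impI ballI)
    fix i assume i: "i < ?k"
    show "pl ?k (g i)"
    proof (cases "i < ?n")
      case True
      then show ?thesis
        using pl_comp[OF f(1)[OF True], of ?k "\<lambda>j x. x j"] by (simp add: g_def pl_coord)
    qed (use i in \<open>auto simp: g_def intro: pl_coord\<close>)
    fix \<eta> :: "real \<Rightarrow> 'v" assume \<eta>: "\<eta> \<in> paths0 T"
    have r: "P r \<eta> \<in> paths0 T" by (rule P_paths0[OF assms(2) \<eta> assms(3)])
    show "coords T (v @ r) \<eta> i = g i (coords T (u @ r) \<eta>)"
    proof (cases "i < ?n")
      case True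
      have "f i (coords T u (P r \<eta>)) = f i (coords T (u @ r) \<eta>)"
        by (rule pl_cong_arg[OF f(1)[OF True]]) (simp add: path_coords_append)
      with True show ?thesis by (simp add: path_coords_append len g_def f(2)[OF True r])
    qed (simp add: path_coords_append len g_def)
  next
    fix \<eta> :: "real \<Rightarrow> 'v" and t :: real assume "\<eta> \<in> paths0 T" "t \<in> {0..T}"
    then show "P (u @ r) \<eta> t = P (v @ r) \<eta> t"
      using eq P_paths0 assms by simp
  qed (use len in simp)
qed

lemma cox_m_ge_2:
  assumes "s \<in> S" "t \<in> S" "s \<noteq> t"
  shows "cox_m W s t \<ge> 2"
proof -
  have "cox_m W s t \<ge> 1"
    unfolding cox_m_def using assms finite_W by (intro ord_ge_1) (auto simp: gen_carrier)
  moreover have "cox_m W s t \<noteq> 1"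
  proof
    assume "cox_m W s t = 1"
    then have "s \<otimes> t = \<one>" using pow_cox_m[OF assms(1,2)] assms by (simp add: gen_carrier)
    then have "s = t" using assms inv_equality[of s t] by (simp add: gen_carrier gen_inv)
    with assms show False by simp
  qed
  ultimately show ?thesis by simp
qed

end

text \<open>The weights are the Chebyshev polynomials of the second kind at
  \<open>cos (pi / m)\<close>; their recursion is the addition theorem.\<close>

lemma rank_two_sin:
  assumes "m \<ge> 2"
  shows "rank_two (2 * cos (pi / real m)) (\<lambda>k. sin (real k * (pi / real m)) / sin (pi / real m)) m"
proof -
  let ?\<theta> = "pi / real m"
  have \<theta>: "0 < ?\<theta>" "?\<theta> \<le> pi / 2" using assms by (auto simp: field_simps)
  have sin0: "sin ?\<theta> > 0" using \<theta> pi_gt_zero by (intro sin_gt_zero) linarith+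
  show ?thesis
  proof
    show "0 \<le> 2 * cos ?\<theta>" using \<theta> by (auto intro!: cos_ge_zero)
    show "sin (real (Suc (Suc k)) * ?\<theta>) / sin ?\<theta> = 2 * cos ?\<theta> * (sin (real (Suc k) * ?\<theta>) / sin ?\<theta>) - sin (real k * ?\<theta>) / sin ?\<theta>" for k
    proof -
      have "real (Suc (Suc k)) * ?\<theta> = real (Suc k) * ?\<theta> + ?\<theta>" "real k * ?\<theta> = real (Suc k) * ?\<theta> - ?\<theta>"
        by (simp_all add: algebra_simps add_divide_distrib)
      then have "sin (real (Suc (Suc k)) * ?\<theta>) + sin (real k * ?\<theta>) = 2 * cos ?\<theta> * sin (real (Suc k) * ?\<theta>)"
        by (simp only: sin_add sin_diff) (simp add: algebra_simps)
      then have eq: "sin (real (Suc (Suc k)) * ?\<theta>) =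
          2 * cos ?\<theta> * sin (real (Suc k) * ?\<theta>) - sin (real k * ?\<theta>)" by linarith
      show ?thesis unfolding eq diff_divide_distrib by simp
    qed
    show "sin (real k * ?\<theta>) / sin ?\<theta> > 0" if "0 < k" "k < m" for k
    proof -
      have "real k * ?\<theta> < real m * ?\<theta>" using that \<theta> by (intro mult_strict_right_mono) auto
      then show ?thesis using that assms by (intro divide_pos_pos[OF _ sin0] sin_gt_zero) auto
    qed
  qed (use assms sin0 in \<open>auto\<close>)
qed

context finite_coxeter_realization
begin

text \<open>Scaling \<open>(\<alpha>, \<alpha>\<^sup>\<or>)\<close> to \<open>(\<kappa> \<alpha>, \<alpha>\<^sup>\<or> / \<kappa>)\<close> makes the Cartan matrix of two generators symmetric.\<close>
lemma symmetric_scaling: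
  assumes "s \<in> S" "t \<in> S" "s \<noteq> t"
  defines "c \<equiv> 2 * cos (pi / real (cox_m W s t))" and "L \<equiv> \<lambda>e. if e then s else t"
  obtains \<kappa> where "\<And>e. \<kappa> e > 0" "\<And>a e. \<kappa> e * \<alpha>v (L a) (\<alpha> (L e)) = car c a e * \<kappa> a"
proof -
  let ?m = "cox_m W s t"
  have m: "?m \<ge> 2" by (rule cox_m_ge_2[OF assms(1-3)])
  have two: "\<alpha>v (L a) (\<alpha> (L a)) = 2" for a using coroot_root assms by (auto simp: L_def)
  show thesis
  proof (cases "?m = 2")
    case True
    then have "c = 0" by (simp add: c_def)
    moreover have "\<alpha>v (L a) (\<alpha> (L e)) = 0" if "a \<noteq> e" for a e
      using cartan_eq_2[OF assms(1-3) True] that by (auto simp: L_def)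
    ultimately show thesis using two by (intro that[of "\<lambda>_. 1"]) (auto simp: car_def)
  next
    case False
    define x where "x = \<alpha>v s (\<alpha> t)"
    define y where "y = \<alpha>v t (\<alpha> s)"
    have [simp]: "\<alpha>v s (\<alpha> s) = 2" "\<alpha>v t (\<alpha> t) = 2" using coroot_root assms by auto
    have xy: "x < 0" "y < 0" "x * y = c\<^sup>2"
      using cartan_neq_2[OF assms(1-3) False] by (auto simp: x_def y_def c_def power_mult_distrib)
    have "c \<ge> 0" using rank_two.c_nonneg[OF rank_two_sin[OF m]] by (simp add: c_def)
    moreover have "c \<noteq> 0" using xy by auto
    ultimately have "c > 0" by simp
    then show thesis
      using xy
      \<comment> \<open>With \<open>c\<close> at \<open>t\<close>, the row of \<open>s\<close>
        forces \<open>- x\<close> at \<open>s\<close>; the row of \<open>t\<close> then reads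
        \<open>x * y = c\<^sup>2\<close>.\<close>
      by (intro that[of "\<lambda>e. if e then - x else c"])
         (auto simp: car_def L_def x_def[symmetric] y_def[symmetric] power2_eq_square)
  qed
qed

section \<open>Transport of the rank two results to a pair of generators\<close>

context
  fixes T :: real and L :: "bool \<Rightarrow> 'w" and \<kappa> :: "bool \<Rightarrow> real" and c :: real
  assumes T: "T \<ge> 0" and LS: "\<And>e. L e \<in> S" and \<kappa>: "\<And>e. \<kappa> e > 0"
    and cartan: "\<And>a e. \<kappa> e * \<alpha>v (L a) (\<alpha> (L e)) = car c a e * \<kappa> a"
begin

definition pair_path :: "(real \<Rightarrow> 'v) \<Rightarrow> bool \<Rightarrow> real \<Rightarrow> real"
  where "pair_path \<eta> e t = \<alpha>v (L e) (clamp_path T \<eta> t) / \<kappa> e"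

text \<open>Reversed, because \<open>foldr\<close> applies the rightmost letter first, whereas
  \<open>stage\<close> numbers the letters in order of application.\<close>

definition pair_word :: "bool \<Rightarrow> nat \<Rightarrow> 'w list"
  where "pair_word b n = rev (map (\<lambda>i. L (letter b i)) [0..<n])"

lemma pair_word_Suc: "pair_word b (Suc n) = L (letter b n) # pair_word b n"
  by (simp add: pair_word_def)

lemma length_pair_word [simp]: "length (pair_word b n) = n"
  by (simp add: pair_word_def)

lemma pair_word_alternating: "pair_word b n = alternating n (L (\<not> letter b n)) (L (letter b n))"
  by (induction n) (simp add: pair_word_def, simp add: pair_word_Suc letter_Suc')

lemma pair_path_cont2: "\<eta> \<in> paths0 T \<Longrightarrow> cont2 (pair_path \<eta>)"
  unfolding pair_path_def using coroot_clamp_continuous[OF LS _ T] \<kappa>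
  by (auto intro!: continuous_intros simp: less_imp_neq[OF \<kappa>, symmetric])

lemma pair_path_0: "\<eta> \<in> paths0 T \<Longrightarrow> pair_path \<eta> e 0 = 0"
  using T linear_0[OF linear_coroot[OF LS]] by (simp add: pair_path_def clamp_path_def paths0_def)

lemma rmax_coroot:
  assumes "continuous_on UNIV (pair_path \<xi> e)" "t \<in> {0..T}"
    and "\<And>u. u \<in> {0..T} \<Longrightarrow> pair_path \<xi> e u = g u"
  shows "rmax (\<lambda>u. - \<alpha>v (L e) (clamp_path T \<xi> u)) t = \<kappa> e * rmax (\<lambda>u. - g u) t"
proof -
  have "rmax (\<lambda>u. - \<alpha>v (L e) (clamp_path T \<xi> u)) t = rmax (\<lambda>u. \<kappa> e * (- pair_path \<xi> e u)) t"
    using \<kappa>[of e] by (intro rmax_cong) (simp add: pair_path_def)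
  also have "\<dots> = \<kappa> e * rmax (\<lambda>u. - pair_path \<xi> e u) t"
    using \<kappa>[of e] assms(1) by (intro rmax_scale) (auto intro!: continuous_intros)
  also have "rmax (\<lambda>u. - pair_path \<xi> e u) t = rmax (\<lambda>u. - g u) t"
    using assms(2,3) by (intro rmax_cong) auto
  finally show ?thesis .
qed

lemma pair_word_lists: "pair_word b n \<in> lists S"
  using LS by (auto simp: pair_word_def)

lemma pair_path_P:
  assumes \<eta>: "\<eta> \<in> paths0 T" and t: "t \<in> {0..T}"
  shows "pair_path (P (pair_word b n) \<eta>) a t = stage c b (pair_path \<eta>) n a t"
  using t
proof (induction n arbitrary: a t)
  case 0
  then show ?case by (simp add: pair_word_def)
next
  case (Suc n)
  let ?\<xi> = "P (pair_word b n) \<eta>" and ?l = "letter b n"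
  have \<xi>: "?\<xi> \<in> paths0 T" by (rule P_paths0[OF pair_word_lists \<eta> T])
  have cx: "continuous_on UNIV (pair_path ?\<xi> ?l)" using pair_path_cont2[OF \<xi>] by simp
  have "P (pair_word b (Suc n)) \<eta> t = ?\<xi> t + (\<kappa> ?l * coord c b (pair_path \<eta>) n t) *\<^sub>R \<alpha> (L ?l)"
    using transform_eq[OF Suc.prems] rmax_coroot[OF cx Suc.prems Suc.IH]
    by (simp add: pair_word_Suc coord_def)
  then have "pair_path (P (pair_word b (Suc n)) \<eta>) a t =
      pair_path ?\<xi> a t + coord c b (pair_path \<eta>) n t * (\<kappa> ?l * \<alpha>v (L a) (\<alpha> (L ?l))) / \<kappa> a"
    using linear_add[OF linear_coroot[OF LS]] linear_scale[OF linear_coroot[OF LS]] Suc.prems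
    by (simp add: pair_path_def clamp_path_eq add_divide_distrib)
  then show ?case
    using \<kappa>[of a] Suc.IH[OF Suc.prems, of a] unfolding cartan by (simp add: push_def coord_def)
qed

lemma coord_pair_word:
  assumes \<eta>: "\<eta> \<in> paths0 T" and t: "t \<in> {0..T}"
  shows "(INF u\<in>{0..t}. \<alpha>v (L (letter b n)) (P (pair_word b n) \<eta> u)) =
    - (\<kappa> (letter b n) * coord c b (pair_path \<eta>) n t)"
proof -
  let ?\<xi> = "P (pair_word b n) \<eta>" and ?l = "letter b n"
  have "?\<xi> \<in> paths0 T" by (rule P_paths0[OF pair_word_lists \<eta> T])
  then have cx: "continuous_on UNIV (pair_path ?\<xi> ?l)" using pair_path_cont2 by simp
  show ?thesis
    unfolding INF_eq_rmax[OF t, of "\<alpha>v (L ?l)" ?\<xi>] coord_def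
    using rmax_coroot[OF cx t pair_path_P[OF \<eta>]] by simp
qed

lemma P_pair_word:
  assumes \<eta>: "\<eta> \<in> paths0 T" and t: "t \<in> {0..T}"
  shows "P (pair_word b n) \<eta> t =
    \<eta> t + (\<Sum>e\<in>UNIV. (\<kappa> e * letter_total c b (pair_path \<eta>) n e t) *\<^sub>R \<alpha> (L e))"
proof (induction n)
  case 0
  then show ?case by (simp add: pair_word_def letter_total_def)
next
  case (Suc n)
  have "P (pair_word b (Suc n)) \<eta> t =
      P (pair_word b n) \<eta> t + (\<kappa> (letter b n) * coord c b (pair_path \<eta>) n t) *\<^sub>R \<alpha> (L (letter b n))"
    by (simp add: pair_word_Suc path_transform_def coord_pair_word[OF \<eta> t])
  then show ?case
    unfolding Suc by (cases "letter b n") (simp_all add: letter_total_def UNIV_bool algebra_simps)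
qed

lemma coords_pair_word:
  assumes \<eta>: "\<eta> \<in> paths0 T" and i: "i < n"
  shows "coords T (pair_word b n) \<eta> i =
    \<kappa> (letter b (n - Suc i)) * coord c b (pair_path \<eta>) (n - Suc i) T"
  using i
proof (induction n arbitrary: i)
  case (Suc n)
  then show ?case
    using T by (cases i) (simp_all add: pair_word_Suc path_coords_Cons coord_pair_word[OF \<eta>])
qed simp

lemma equiv_pair_words:
  assumes "rank_two c \<sigma> m"
  shows "equiv_words T (pair_word b m) (pair_word b' m)"
proof -
  interpret rank_two c \<sigma> m by (rule assms)
  obtain \<phi> where \<phi>: "\<And>j. j < m \<Longrightarrow> pl m (\<phi> j)"
    "\<And>j z. \<lbrakk>j < m; cont2 z; \<And>e. z e 0 = 0\<rbrakk> \<Longrightarrow> coord c b' z j T = \<phi> j (\<lambda>i. coord c b z i T)"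
    using coord_change[of b' b] T by metis
  \<comment> \<open>Coordinates of words are numbered from the left and carry the factor
    \<open>\<kappa>\<close>: both are undone before \<open>\<phi>\<close> and restored after
    it.\<close>
  define f where "f = (\<lambda>i x. \<kappa> (letter b' (m - Suc i)) *
      \<phi> (m - Suc i) (\<lambda>j. (1 / \<kappa> (letter b j)) * x (m - Suc j)))"
  show ?thesis
    unfolding equiv_words_def
  proof (intro conjI exI[of _ f] allI impI ballI)
    fix i assume i: "i < length (pair_word b m)"
    then show "pl (length (pair_word b m)) (f i)"
      unfolding f_def length_pair_word by (intro pl_scale pl_comp[OF \<phi>(1)] pl_coord) auto
    fix \<eta> :: "real \<Rightarrow> 'v" assume \<eta>: "\<eta> \<in> paths0 T"
    have "\<phi> (m - Suc i) (\<lambda>j. coord c b (pair_path \<eta>) j T) =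
        \<phi> (m - Suc i) (\<lambda>j. (1 / \<kappa> (letter b j)) * coords T (pair_word b m) \<eta> (m - Suc j))"
    proof (rule pl_cong_arg[OF \<phi>(1)])
      fix j assume "j < m"
      then show "coord c b (pair_path \<eta>) j T = (1 / \<kappa> (letter b j)) * coords T (pair_word b m) \<eta> (m - Suc j)"
        using \<kappa>[of "letter b j"] by (simp add: coords_pair_word[OF \<eta>])
    qed (use i in simp)
    then show "coords T (pair_word b' m) \<eta> i = f i (coords T (pair_word b m) \<eta>)"
      using i by (simp add: coords_pair_word[OF \<eta>] f_def \<phi>(2) pair_path_cont2[OF \<eta>] pair_path_0[OF \<eta>])
  next
    fix \<eta> :: "real \<Rightarrow> 'v" and t :: real assume \<eta>: "\<eta> \<in> paths0 T" and t: "t \<in> {0..T}"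
    show "P (pair_word b m) \<eta> t = P (pair_word b' m) \<eta> t"
      unfolding P_pair_word[OF \<eta> t] letter_total_braid[OF pair_path_cont2[OF \<eta>], of b _ _ b'] ..
  qed simp
qed

end

lemma equiv_braid:
  assumes "s \<in> S" "t \<in> S" "s \<noteq> t" "T \<ge> 0"
  shows "equiv_words T (alternating (cox_m W s t) s t) (alternating (cox_m W s t) t s)"
proof -
  let ?m = "cox_m W s t" and ?L = "\<lambda>e. if e then s else t"
  let ?c = "2 * cos (pi / real ?m)"
  obtain \<kappa> where \<kappa>: "\<And>e. \<kappa> e > 0" "\<And>a e. \<kappa> e * \<alpha>v (?L a) (\<alpha> (?L e)) = car ?c a e * \<kappa> a"
    using symmetric_scaling[OF assms(1-3)] by blast
  have LS: "?L e \<in> S" for e using assms by simp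
  \<comment> \<open>The parity is arranged so that the leftmost letter, of index
    \<open>?m - 1\<close>, is \<open>True\<close>, which stands for \<open>s\<close>.\<close>
  define b where "b = letter False ?m"
  have "letter b ?m = False" by (simp add: b_def letter_def)
  then have "alternating ?m s t = pair_word ?L b ?m" "alternating ?m t s = pair_word ?L (\<not> b) ?m"
    using pair_word_alternating[OF assms(4) LS \<kappa>, of _ ?m] by (simp_all add: letter_Not)
  then show ?thesis
    using equiv_pair_words[OF assms(4) LS \<kappa> rank_two_sin[OF cox_m_ge_2[OF assms(1-3)]]] by simp
qed

theorem reduced_equiv_words:
  assumes "T \<ge> 0" "reduced_decomposition W S u w" "reduced_decomposition W S v w"
  shows "equiv_words T u v"
proof (rule matsumoto[where E = "equiv_words T", OF _ _ equiv_words_trans equiv_words_Cons _ assms(2,3)])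
  show "equiv_words T [] []" by (simp add: equiv_words_def)
  show "cox_m W s t > 0" if "s \<in> S" "t \<in> S" "s \<noteq> t" for s t
    using cox_m_ge_2[OF that] by simp
  show "equiv_words T (alternating (cox_m W s t) s t @ r) (alternating (cox_m W s t) t s @ r)"
    if "s \<in> S" "t \<in> S" "s \<noteq> t" "r \<in> lists S" for s t r
    using equiv_braid[OF that(1-3) assms(1)] that(4) assms(1) by (rule equiv_words_append)
qed

end

theorem theorem3p12:
  fixes W :: "('w, 'm) monoid_scheme" and S :: "'w set"
    and \<rho> :: "'w \<Rightarrow> 'v::euclidean_space \<Rightarrow> 'v"
    and \<alpha> :: "'w \<Rightarrow> 'v" and \<alpha>v :: "'w \<Rightarrow> 'v \<Rightarrow> real"
    and T :: real and w :: 'w and p :: nat and ii jj :: "'w list"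
  assumes "finite_coxeter_realization W S \<rho> \<alpha> \<alpha>v"
    and "T > 0"
    and "w \<in> carrier W" and "cox_length W S w = p"
    and "reduced_decomposition W S ii w" and "reduced_decomposition W S jj w"
  shows "\<exists>\<phi>. piecewise_linear p p \<phi> \<and>
      continuous_map (Euclidean_space p) (Euclidean_space p) \<phi> \<and>
      (\<forall>\<eta>\<in>paths0 T. path_coords \<alpha> \<alpha>v T jj \<eta> = \<phi> (path_coords \<alpha> \<alpha>v T ii \<eta>))"
proof -
  interpret finite_coxeter_realization W S \<rho> \<alpha> \<alpha>v by (rule assms(1))
  have len: "length ii = p" "length jj = p"
    using assms(4-6) by (auto simp: reduced_decomposition_def)
  have "equiv_words T ii jj"
    using reduced_equiv_words[OF _ assms(5,6)] assms(2) by simp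
  then obtain f where f: "\<And>i. i < p \<Longrightarrow> pl p (f i)"
    "\<And>i \<eta>. \<lbrakk>i < p; \<eta> \<in> paths0 T\<rbrakk> \<Longrightarrow> path_coords \<alpha> \<alpha>v T jj \<eta> i = f i (path_coords \<alpha> \<alpha>v T ii \<eta>)"
    unfolding equiv_words_def len by blast
  show ?thesis
  \<comment> \<open>The value 0 from \<open>p\<close> on agrees with the default of
    \<open>path_coords\<close>, so the equation holds for whole functions.\<close>
  proof (intro exI[of _ "\<lambda>x i. if i < p then f i x else 0"] conjI ballI)
    show "path_coords \<alpha> \<alpha>v T jj \<eta> = (\<lambda>i. if i < p then f i (path_coords \<alpha> \<alpha>v T ii \<eta>) else 0)"
      if "\<eta> \<in> paths0 T" for \<eta>
      using f(2)[OF _ that] by (auto simp: path_coords_def len)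
  qed (use pl_family_map[of p p f, OF f(1)] in auto)
qed

end
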